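(* The Ranking algorithm is at most $0.5671$-competitive for Fully Online Bipartite Matching: $\inf \mathbb{E}[|\mathrm{Ranking}(I)|]/\mathrm{OPT}(I) \le 0.5671$, where the infimum is over all instances $I$ with a bipartite underlying graph and $\mathrm{OPT}(I)$ is the maximum matching size.
   Context: Fully Online Bipartite Matching: a bipartite graph $G=(V,E)$ is initially unknown. Time proceeds in steps, each being either the arrival of a vertex $v$ (edges between $v$ and previously-arrived vertices are revealed) or the deadline of a vertex $v$. Each vertex's deadline occurs after its own arrival and after the arrivals of all its neighbours. At the deadline of $v$, if $v$ is not already matched, the algorithm must irrevocably either match $v$ to a currently unmatched neighbour or leave it unmatched. Ranking: when $v$ arrives, draw $y_v$ uniformly from $[0,1)$ independently; at the deadline of an unmatched $v$, match it to its unmatched neighbour of smallest rank if one exists, otherwise leave it unmatched.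
   Formalization: The bound 0.5671 is read as a value rounded to four decimals: the infimum is shown to be less than 0.56715, since the exact infimum is the Omega constant 0.567143..., which exceeds 0.5671. Instances with OPT(I) = 0 are excluded. *)

theory Defs
  imports "HOL-Probability.Probability"
begin

datatype 'v event = Arrival 'v | Deadline 'v

record 'v fo_instance =
  verts :: "'v set"
  edges :: "'v set set"
  timeline :: "'v event list"

definition before :: "'a list \<Rightarrow> 'a \<Rightarrow> 'a \<Rightarrow> bool" where
  "before xs a b \<longleftrightarrow> (\<exists>i j. i < j \<and> j < length xs \<and> xs ! i = a \<and> xs ! j = b)"

definition neighbours :: "'v fo_instance \<Rightarrow> 'v \<Rightarrow> 'v set" where
  "neighbours I v = {u. {u, v} \<in> edges I}"

definition fully_online_instance :: "'v fo_instance \<Rightarrow> bool" where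
  "fully_online_instance I \<longleftrightarrow>
     finite (verts I) \<and>
     (\<forall>e\<in>edges I. \<exists>u\<in>verts I. \<exists>v\<in>verts I. u \<noteq> v \<and> e = {u, v}) \<and>
     distinct (timeline I) \<and>
     set (timeline I) = Arrival ` verts I \<union> Deadline ` verts I \<and>
     (\<forall>v\<in>verts I. \<forall>u\<in>insert v (neighbours I v). before (timeline I) (Arrival u) (Deadline v))"

definition bipartite :: "'v fo_instance \<Rightarrow> bool" where
  "bipartite I \<longleftrightarrow>
     (\<exists>L R. L \<union> R = verts I \<and> L \<inter> R = {} \<and> (\<forall>e\<in>edges I. \<exists>u\<in>L. \<exists>v\<in>R. e = {u, v}))"

definition is_matching :: "'v fo_instance \<Rightarrow> 'v set set \<Rightarrow> bool" where
  "is_matching I M \<longleftrightarrow> M \<subseteq> edges I \<and> pairwise disjnt M"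

definition opt :: "'v fo_instance \<Rightarrow> nat" where
  "opt I = Max (card ` {M. is_matching I M})"

text \<open>
  The state of Ranking is the set of edges matched so far, so \<open>\<Union>M\<close> is the set of matched
  vertices. All neighbours of a vertex have arrived by its deadline, hence the candidates need
  not be restricted to arrived vertices. Ties between ranks have probability zero.
\<close>

fun ranking_step :: "'v fo_instance \<Rightarrow> ('v \<Rightarrow> real) \<Rightarrow> 'v set set \<Rightarrow> 'v event \<Rightarrow> 'v set set" where
  "ranking_step I y M (Arrival v) = M"
| "ranking_step I y M (Deadline v) =
     (let A = neighbours I v - \<Union>M
      in if v \<in> \<Union>M \<or> A = {} then M else insert {v, arg_min_on y A} M)"

definition ranking :: "'v fo_instance \<Rightarrow> ('v \<Rightarrow> real) \<Rightarrow> 'v set set" where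
  "ranking I y = foldl (ranking_step I y) {} (timeline I)"

text \<open>
  Instances are fixed independently of the ranks, so drawing the rank of each vertex at its
  arrival amounts to drawing all ranks in advance.
\<close>

definition rank_measure :: "'v fo_instance \<Rightarrow> ('v \<Rightarrow> real) measure" where
  "rank_measure I = (\<Pi>\<^sub>M v\<in>verts I. uniform_measure lborel {0..<1})"

definition expected_ranking :: "'v fo_instance \<Rightarrow> real" where
  "expected_ranking I = (\<integral>y. real (card (ranking I y)) \<partial>rank_measure I)"

text \<open>
  Every finite graph is isomorphic to one on natural numbers. Instances without edges, for
  which the ratio is 0/0, are excluded.
\<close>

definition bipartite_instances :: "nat fo_instance set" where
  "bipartite_instances = {I. fully_online_instance I \<and> bipartite I \<and> opt I > 0}"

text \<open>
  The value of the infimum below known from the literature is the Omega constant \<open>0.567143\<dots>\<close>, the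
  solution of \<open>x * exp x = 1\<close>. The usual figure \<open>0.5671\<close> is this value rounded to four decimals,
  and is itself slightly too small to be an upper bound.
\<close>

definition ranking_ratio :: real where
  "ranking_ratio = (INF I\<in>bipartite_instances. expected_ranking I / real (opt I))"

text \<open>
  The Bochner integral is 0 on non-integrable functions and \<open>INF\<close> on the reals is unspecified
  for empty or unbounded sets; the following facts rule these cases out.
\<close>

lemma prob_space_rank: "prob_space (rank_measure I)"
  unfolding rank_measure_def
  by (intro prob_space_PiM prob_space_uniform_measure) auto

lemma finite_matchings:
  assumes "fully_online_instance I"
  shows "finite {M. is_matching I M}"
proof -
  have "edges I \<subseteq> Pow (verts I)" and "finite (verts I)"
    using assms by (auto simp: fully_online_instance_def)
  then have "finite (edges I)"
    by (meson finite_Pow_iff finite_subset)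
  then have "finite (Pow (edges I))" by simp
  then show ?thesis
    by (rule finite_subset[rotated]) (auto simp: is_matching_def)
qed

lemma ranking_cong:
  assumes "edges I \<subseteq> Pow (verts I)"
    and eq: "\<And>u v. u \<in> verts I \<Longrightarrow> v \<in> verts I \<Longrightarrow> y u < y v \<longleftrightarrow> z u < z v"
  shows "ranking I y = ranking I z"
proof -
  have "ranking_step I y M e = ranking_step I z M e" for M e
  proof (cases e)
    case (Deadline v)
    have "neighbours I v \<subseteq> verts I" using assms(1) by (auto simp: neighbours_def)
    then have "arg_min_on y (neighbours I v - \<Union>M) = arg_min_on z (neighbours I v - \<Union>M)"
      unfolding arg_min_on_def arg_min_def is_arg_min_def
      using eq by (intro arg_cong[where f = Eps] ext) blast
    then show ?thesis by (simp add: Deadline Let_def)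
  qed simp
  then have "ranking_step I y = ranking_step I z" by blast
  then show ?thesis by (simp add: ranking_def)
qed

lemma ranking_is_matching:
  assumes "fully_online_instance I"
  shows "is_matching I (ranking I y)"
proof -
  have fin: "finite (neighbours I v)" for v
  proof (rule finite_subset)
    show "neighbours I v \<subseteq> verts I" "finite (verts I)"
      using assms by (fastforce simp: fully_online_instance_def neighbours_def)+
  qed
  have step: "is_matching I (ranking_step I y M e)" if "is_matching I M" for M e
  proof (cases e)
    case (Deadline v)
    define A where "A = neighbours I v - \<Union>M"
    show ?thesis
    proof (cases "v \<in> \<Union>M \<or> A = {}")
      case False
      define u where "u = arg_min_on y A"
      have "u \<in> A" unfolding u_def
        using False fin by (intro arg_min_if_finite(1)) (auto simp: A_def)
      then have "{v, u} \<in> edges I" "u \<notin> \<Union>M"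
        by (auto simp: A_def neighbours_def insert_commute)
      moreover have "ranking_step I y M e = insert {v, u} M"
        using False by (simp add: Deadline Let_def A_def[symmetric] u_def)
      ultimately show ?thesis
        using that False by (auto simp: is_matching_def pairwise_insert disjnt_def)
    qed (use that in \<open>simp add: Deadline Let_def A_def\<close>)
  qed (use that in simp)
  have "is_matching I (foldl (ranking_step I y) M es)" if "is_matching I M" for M es
    using that by (induction es arbitrary: M) (auto intro: step)
  moreover have "is_matching I {}" by (simp add: is_matching_def)
  ultimately show ?thesis by (simp add: ranking_def)
qed

lemma card_ranking_le_opt:
  assumes "fully_online_instance I"
  shows "card (ranking I y) \<le> opt I"
  unfolding opt_def
  using finite_matchings[OF assms] ranking_is_matching[OF assms] by (intro Max_ge) auto

lemma integrable_ranking: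
  assumes "fully_online_instance I"
  shows "integrable (rank_measure I) (\<lambda>y. real (card (ranking I y)))"
proof -
  let ?V = "verts I" and ?M = "rank_measure I"
  interpret prob_space ?M by (rule prob_space_rank)
  have finV: "finite ?V" and sub: "edges I \<subseteq> Pow ?V"
    using assms by (auto simp: fully_online_instance_def)
  define P where "P y = {(u, v) \<in> ?V \<times> ?V. y u < y v}" for y :: "'a \<Rightarrow> real"
  define f where "f p = real (card (ranking I (SOME y. P y = p)))" for p
  have f: "real (card (ranking I y)) = f (P y)" for y
  proof -
    define z where "z = (SOME z. P z = P y)"
    have "P z = P y" unfolding z_def by (rule someI[of "\<lambda>z. P z = P y" y]) simp
    have "z u < z v \<longleftrightarrow> y u < y v" if "u \<in> ?V" "v \<in> ?V" for u v
    proof -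
      have "(u, v) \<in> P z \<longleftrightarrow> (u, v) \<in> P y" using \<open>P z = P y\<close> by simp
      then show ?thesis using that by (simp add: P_def)
    qed
    then have "ranking I z = ranking I y" by (intro ranking_cong sub) blast
    then have "ranking I (SOME z. P z = P y) = ranking I y" by (simp add: z_def)
    then show ?thesis by (simp add: f_def)
  qed
  have cmp: "Measurable.pred ?M (\<lambda>y. y u < y v)" if "u \<in> ?V" "v \<in> ?V" for u v
  proof -
    have "(\<lambda>y. y w) \<in> borel_measurable ?M" if "w \<in> ?V" for w
      unfolding rank_measure_def using that by measurable
    with that show ?thesis by measurable
  qed
  have "P \<in> measurable ?M (count_space (Pow (?V \<times> ?V)))"
  proof (rule measurable_count_space_eq2[THEN iffD2], simp add: finV, intro conjI ballI)
    show "P \<in> space ?M \<rightarrow> Pow (?V \<times> ?V)" by (auto simp: P_def)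
    fix p assume p: "p \<in> Pow (?V \<times> ?V)"
    have "P y = p \<longleftrightarrow> (\<forall>u\<in>?V. \<forall>v\<in>?V. (y u < y v) = ((u, v) \<in> p))" for y
      unfolding P_def using p by fast
    then have "P -` {p} \<inter> space ?M =
        {y \<in> space ?M. \<forall>u\<in>?V. \<forall>v\<in>?V. (y u < y v) = ((u, v) \<in> p)}"
      by blast
    also have "\<dots> \<in> sets ?M"
    proof (intro sets.sets_Collect_finite_All finV)
      fix u v assume "u \<in> ?V" "v \<in> ?V"
      then have [measurable]: "Measurable.pred ?M (\<lambda>y. y u < y v)" by (rule cmp)
      show "{y \<in> space ?M. (y u < y v) = ((u, v) \<in> p)} \<in> sets ?M" by measurable
    qed
    finally show "P -` {p} \<inter> space ?M \<in> sets ?M" .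
  qed
  then have "(\<lambda>y. f (P y)) \<in> borel_measurable ?M"
    by (rule measurable_compose) simp
  then have "(\<lambda>y. real (card (ranking I y))) \<in> borel_measurable ?M"
    by (simp add: f)
  then show ?thesis
    using card_ranking_le_opt[OF assms]
    by (intro integrable_const_bound[where B = "real (opt I)"]) auto
qed

lemma bipartite_instances_nonempty: "bipartite_instances \<noteq> {}"
proof -
  define I :: "nat fo_instance" where
    "I = \<lparr>verts = {0, 1}, edges = {{0, 1}},
          timeline = [Arrival 0, Arrival 1, Deadline 0, Deadline 1]\<rparr>"
  have "before (timeline I) (Arrival u) (Deadline v)" if "u \<in> {0, 1}" "v \<in> {0, 1}" for u v
    unfolding before_def using that
    by (intro exI[of _ u] exI[of _ "v + 2"]) (auto simp: I_def)
  then have valid: "fully_online_instance I"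
    by (auto simp: fully_online_instance_def I_def neighbours_def doubleton_eq_iff)
  have "bipartite I"
    unfolding bipartite_def by (intro exI[of _ "{0}"] exI[of _ "{1}"]) (auto simp: I_def)
  moreover have "is_matching I {{0, 1}}" by (auto simp: is_matching_def I_def)
  then have "card {{0, 1 :: nat}} \<le> opt I"
    unfolding opt_def using finite_matchings[OF valid]
    by (intro Max_ge finite_imageI) (metis image_eqI mem_Collect_eq)+
  then have "opt I > 0" by simp
  ultimately show ?thesis using valid by (auto simp: bipartite_instances_def)
qed

lemma bdd_below_ranking_ratio:
  "bdd_below ((\<lambda>I. expected_ranking I / real (opt I)) ` bipartite_instances)"
  by (intro bdd_belowI2[where m = 0] divide_nonneg_nonneg)
     (simp_all add: expected_ranking_def)

end

theory Submission
  imports Defs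
begin

text \<open>
  The instance has \<open>K\<close> levels of \<open>n\<close> pool vertices. Every pool vertex has a private partner of
  degree one and is adjacent to the whole next level; pool vertices reach their deadlines level by
  level. Each matched edge has exactly one active pool vertex, so the ratio is the average fraction
  of pool vertices that are still unmatched at their own deadlines. If the previous level had an
  active fraction \<open>a\<close> and the next level has already lost all ranks below \<open>x\<close>, an active vertex
  takes its partner with probability \<open>x\<close> and a next-level vertex with probability \<open>1 - x\<close>, so
  after \<open>s * n\<close> active deadlines \<open>1 - x\<close> has decayed to \<open>exp (- s)\<close>, and the next active
  fraction is \<open>exp (- a)\<close>. Iterating converges to the fixed point \<open>\<omega> = exp (- \<omega>)\<close>. The deviation from this fluid limit is controlled in mean
  square: integrating over the rank of the fresh partner, every deadline contracts the deviation up
  to an error coming from the empirical distribution of the ranks of the next level.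
\<close>

section \<open>Independent uniform ranks\<close>

abbreviation unif :: "real measure" where
  "unif \<equiv> uniform_measure lborel {0..<1}"

abbreviation ranks :: "'v set \<Rightarrow> ('v \<Rightarrow> real) measure" where
  "ranks V \<equiv> \<Pi>\<^sub>M v\<in>V. unif"

lemma prob_space_unif: "prob_space unif"
  by (intro prob_space_uniform_measure) auto

lemma prob_space_ranks: "prob_space (ranks V)"
  by (intro prob_space_PiM prob_space_unif)

lemma borel_measurable_rank: "v \<in> V \<Longrightarrow> (\<lambda>y. y v) \<in> borel_measurable (ranks V)"
  by measurable

lemma measure_unif_lessThan: "measure unif {..<s} = max 0 (min s 1)"
proof -
  have "{0..<1} \<inter> {..<s} = {0..<max 0 (min s 1)}" by auto
  then show ?thesis by simp
qed

lemma AE_unif_neq: "AE t in unif. t \<noteq> s"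
  by (rule AE_uniform_measureI) (auto intro: AE_mp[OF AE_lborel_singleton])

lemma integral_ranks_coordinate_nonneg:
  fixes f :: "('v \<Rightarrow> real) \<Rightarrow> real"
  assumes "finite V" "q \<in> V" "integrable (ranks V) f"
    and "\<And>x. 0 \<le> (\<integral>t. f (x(q := t)) \<partial>unif)"
  shows "0 \<le> (\<integral>x. f x \<partial>ranks V)"
proof -
  interpret product_prob_space "\<lambda>_. unif" V
    by (intro product_prob_spaceI prob_space_unif)
  have V: "insert q (V - {q}) = V" using assms(2) by auto
  have "(\<integral>x. f x \<partial>ranks V) = (\<integral>x. (\<integral>t. f (x(q := t)) \<partial>unif) \<partial>ranks (V - {q}))"
    using product_integral_insert[of "V - {q}" q f] assms V by simp
  also have "\<dots> \<ge> 0" by (intro Bochner_Integration.integral_nonneg assms(4))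
  finally show ?thesis .
qed

lemma borel_measurable_ranks_order_invariant:
  fixes f :: "('v \<Rightarrow> real) \<Rightarrow> real"
  assumes finV: "finite V"
    and inv: "\<And>y z. (\<And>u v. u \<in> V \<Longrightarrow> v \<in> V \<Longrightarrow> y u < y v \<longleftrightarrow> z u < z v) \<Longrightarrow> f y = f z"
  shows "f \<in> borel_measurable (ranks V)"
proof -
  let ?M = "ranks V"
  define P where "P y = {(u, v) \<in> V \<times> V. y u < y v}" for y :: "'v \<Rightarrow> real"
  define c where "c p = f (SOME y. P y = p)" for p
  have cP: "c (P y) = f y" for y
  proof -
    have "P (SOME z. P z = P y) = P y" by (rule someI[of "\<lambda>z. P z = P y" y]) simp
    then have "f (SOME z. P z = P y) = f y"
      by (intro inv) (auto simp: P_def set_eq_iff)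
    then show ?thesis by (simp add: c_def)
  qed
  have "f y = (\<Sum>p\<in>Pow (V \<times> V). if P y = p then c p else 0)" for y
  proof -
    have "P y \<in> Pow (V \<times> V)" by (auto simp: P_def)
    then show ?thesis using finV by (simp add: cP)
  qed
  moreover have "(\<lambda>y. if P y = p then c p else 0) \<in> borel_measurable ?M"
    if "p \<in> Pow (V \<times> V)" for p
  proof -
    have "P y = p \<longleftrightarrow> (\<forall>u\<in>V. \<forall>v\<in>V. (y u < y v) = ((u, v) \<in> p))" for y
      unfolding P_def using that by fast
    moreover have "Measurable.pred ?M (\<lambda>y. \<forall>u\<in>V. \<forall>v\<in>V. (y u < y v) = ((u, v) \<in> p))"
    proof (intro pred_intros_finite finV)
      fix u v assume "u \<in> V" "v \<in> V"
      then have "(\<lambda>y. y u) \<in> borel_measurable ?M" "(\<lambda>y. y v) \<in> borel_measurable ?M"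
        by measurable
      then show "Measurable.pred ?M (\<lambda>y. (y u < y v) = ((u, v) \<in> p))" by measurable
    qed
    ultimately have [measurable]: "Measurable.pred ?M (\<lambda>y. P y = p)" by simp
    show ?thesis by measurable
  qed
  ultimately show ?thesis by (subst ext[of f]) (auto intro: borel_measurable_sum)
qed

lemma integrable_ranks_bounded:
  fixes f :: "('v \<Rightarrow> real) \<Rightarrow> real"
  assumes "f \<in> borel_measurable (ranks V)" "\<And>y. \<bar>f y\<bar> \<le> B"
  shows "integrable (ranks V) f"
proof -
  interpret prob_space "ranks V" by (rule prob_space_ranks)
  show ?thesis using assms by (intro integrable_const_bound[where B = B]) auto
qed

lemma second_moment_empirical:
  assumes "finite V" "W \<subseteq> V" "0 \<le> s" "s \<le> 1"
  shows "integrable (ranks V) (\<lambda>y. (\<Sum>v\<in>W. indicator {..<s} (y v) - s)\<^sup>2) \<and>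
    (\<integral>y. (\<Sum>v\<in>W. indicator {..<s} (y v) - s)\<^sup>2 \<partial>ranks V) \<le> card W"
proof -
  interpret prob_space "ranks V" by (rule prob_space_ranks)
  interpret U: prob_space unif by (rule prob_space_unif)
  define h where "h t = indicator {..<s} t - s" for t :: real
  have [measurable]: "h \<in> borel_measurable borel" unfolding h_def by measurable
  have h1: "\<bar>h t\<bar> \<le> 1" for t using assms by (auto simp: h_def indicator_def)
  have hint: "integrable unif h" "integrable unif (\<lambda>t. (h t)\<^sup>2)"
    using h1 by (auto intro!: U.integrable_const_bound[where B = 1] simp: abs_square_le_1)
  have "integrable unif (indicator {..<s} :: real \<Rightarrow> real)"
    by (rule U.integrable_const_bound[where B = 1]) (auto simp: indicator_def)
  then have h0: "(\<integral>t. h t \<partial>unif) = 0"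
    unfolding h_def using measure_unif_lessThan[of s] assms(3,4)
    by (subst Bochner_Integration.integral_diff) (auto simp: U.prob_space less_top[symmetric])
  have h2: "(\<integral>t. (h t)\<^sup>2 \<partial>unif) \<le> 1"
    using h1 by (intro U.integral_le_const hint) (auto simp: abs_square_le_1)
  have int: "integrable (ranks V) (\<lambda>y. (\<Sum>v\<in>W. h (y v))\<^sup>2)" if "W \<subseteq> V" for W
  proof (rule integrable_ranks_bounded)
    have "(\<lambda>y. h (y v)) \<in> borel_measurable (ranks V)" if "v \<in> W" for v
    proof -
      have "(\<lambda>y. y v) \<in> borel_measurable (ranks V)" using that \<open>W \<subseteq> V\<close> by (intro borel_measurable_rank) auto
      then show ?thesis by measurable
    qed
    then show "(\<lambda>y. (\<Sum>v\<in>W. h (y v))\<^sup>2) \<in> borel_measurable (ranks V)"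
      by (intro borel_measurable_power borel_measurable_sum)
    fix y :: "'a \<Rightarrow> real"
    have "\<bar>\<Sum>v\<in>W. h (y v)\<bar> \<le> (\<Sum>v\<in>W. 1)" by (rule order.trans[OF sum_abs sum_mono[OF h1]])
    then have "\<bar>\<Sum>v\<in>W. h (y v)\<bar>\<^sup>2 \<le> (real (card W))\<^sup>2" by (intro power_mono) auto
    then show "\<bar>(\<Sum>v\<in>W. h (y v))\<^sup>2\<bar> \<le> (real (card W))\<^sup>2" by simp
  qed
  have "finite W" using assms finite_subset by blast
  then have "(\<integral>y. (\<Sum>v\<in>W. h (y v))\<^sup>2 \<partial>ranks V) \<le> card W" using assms(2)
  proof (induction W)
    case (insert q W)
    let ?S = "\<lambda>y. \<Sum>v\<in>W. h (y v)"
    have "0 \<le> (\<integral>y. (?S y)\<^sup>2 + 1 - (\<Sum>v\<in>insert q W. h (y v))\<^sup>2 \<partial>ranks V)"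
    proof (rule integral_ranks_coordinate_nonneg[OF assms(1)])
      show "q \<in> V" using insert by auto
      show "integrable (ranks V) (\<lambda>y. (?S y)\<^sup>2 + 1 - (\<Sum>v\<in>insert q W. h (y v))\<^sup>2)"
        using insert by (intro Bochner_Integration.integrable_diff Bochner_Integration.integrable_add int) auto
      fix x :: "'a \<Rightarrow> real"
      have eq: "?S (x(q := t)) = ?S x" for t using insert by (intro sum.cong) auto
      have "(\<integral>t. (?S (x(q := t)))\<^sup>2 + 1 - (\<Sum>v\<in>insert q W. h ((x(q := t)) v))\<^sup>2 \<partial>unif)
          = (\<integral>t. 1 - (h t)\<^sup>2 - 2 * ?S x * h t \<partial>unif)"
      proof (intro Bochner_Integration.integral_cong refl)
        fix t
        have "(\<Sum>v\<in>insert q W. h ((x(q := t)) v)) = h t + ?S (x(q := t))"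
          using insert by (subst sum.insert) auto
        then show "(?S (x(q := t)))\<^sup>2 + 1 - (\<Sum>v\<in>insert q W. h ((x(q := t)) v))\<^sup>2
          = 1 - (h t)\<^sup>2 - 2 * ?S x * h t"
          unfolding eq by (simp add: power2_sum)
      qed
      also have "\<dots> = 1 - (\<integral>t. (h t)\<^sup>2 \<partial>unif)"
        using hint h0 by (simp add: U.prob_space)
      finally show "0 \<le> (\<integral>t. (?S (x(q := t)))\<^sup>2 + 1 - (\<Sum>v\<in>insert q W. h ((x(q := t)) v))\<^sup>2 \<partial>unif)"
        using h2 by simp
    qed
    also have "\<dots> = (\<integral>y. (?S y)\<^sup>2 \<partial>ranks V) + 1 - (\<integral>y. (\<Sum>v\<in>insert q W. h (y v))\<^sup>2 \<partial>ranks V)"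
      using insert.prems int[of W] int[of "insert q W"] by (simp add: prob_space)
    finally show ?case using insert by simp
  qed simp
  then show ?thesis using int[OF assms(2)] by (simp add: h_def)
qed

lemma abs_le_square_split:
  fixes x \<epsilon> :: real
  assumes "\<epsilon> > 0"
  shows "\<bar>x\<bar> \<le> \<epsilon> + x\<^sup>2 / \<epsilon>"
proof -
  have "0 \<le> (\<bar>x\<bar> - \<epsilon>)\<^sup>2 + \<epsilon> * \<bar>x\<bar>" using assms by simp
  then have "\<bar>x\<bar> * \<epsilon> \<le> \<epsilon> * \<epsilon> + x\<^sup>2" by (simp add: power2_diff algebra_simps power2_eq_square)
  then show ?thesis using assms by (simp add: field_simps)
qed

definition grid_deviation :: "'v set \<Rightarrow> nat \<Rightarrow> ('v \<Rightarrow> real) \<Rightarrow> real" where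
  "grid_deviation W L y =
     1 / L + (\<Sum>l\<le>L. \<bar>card {v \<in> W. y v < real l / L} / card W - real l / L\<bar>)"

lemma expectation_grid_deviation:
  fixes \<epsilon> :: real
  assumes "finite V" "W \<subseteq> V" "W \<noteq> {}" "L > 0" "\<epsilon> > 0"
  shows "integrable (ranks V) (grid_deviation W L) \<and>
    (\<integral>y. grid_deviation W L y \<partial>ranks V) \<le> 1 / L + (real L + 1) * (\<epsilon> + 1 / (card W * \<epsilon>))"
proof -
  interpret prob_space "ranks V" by (rule prob_space_ranks)
  have finW: "finite W" using assms finite_subset by blast
  then have c0: "card W > 0" using assms by (simp add: card_gt_0_iff)
  define d where "d l y = \<bar>card {v \<in> W. y v < real l / L} / card W - real l / L\<bar>"
    for l and y :: "'a \<Rightarrow> real"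
  have d: "integrable (ranks V) (d l) \<and> (\<integral>y. d l y \<partial>ranks V) \<le> \<epsilon> + 1 / (card W * \<epsilon>)"
    if "l \<le> L" for l
  proof -
    define s where "s = real l / L"
    have s: "0 \<le> s" "s \<le> 1" using that assms by (auto simp: s_def)
    define Q where "Q y = (\<Sum>v\<in>W. indicator {..<s} (y v) - s)\<^sup>2" for y :: "'a \<Rightarrow> real"
    have Q: "integrable (ranks V) Q" "(\<integral>y. Q y \<partial>ranks V) \<le> card W"
      using second_moment_empirical[OF assms(1,2) s] unfolding Q_def[abs_def] by blast+
    have deq: "d l y = \<bar>\<Sum>v\<in>W. indicator {..<s} (y v) - s\<bar> / card W" for y
    proof -
      have "(\<Sum>v\<in>W. indicator {..<s} (y v)) = real (card {v \<in> W. y v < s})"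
        using finW by (simp add: indicator_def sum.If_cases Int_def)
      then have "(\<Sum>v\<in>W. indicator {..<s} (y v) - s) = card {v \<in> W. y v < s} - card W * s"
        by (simp add: sum_subtractf)
      also have "\<dots> = (card {v \<in> W. y v < s} / card W - s) * card W"
        using c0 by (simp add: field_simps)
      finally show ?thesis using c0 by (simp add: d_def s_def abs_mult)
    qed
    have le: "d l y \<le> \<epsilon> + Q y / ((card W)\<^sup>2 * \<epsilon>)" for y
    proof -
      have sq: "Q y / (card W)\<^sup>2 = (d l y)\<^sup>2" by (simp add: deq Q_def power_divide)
      have "0 \<le> d l y" by (simp add: d_def)
      then show ?thesis
        using abs_le_square_split[OF assms(5), of "d l y"] by (simp add: sq[symmetric])
    qed
    have di: "integrable (ranks V) (d l)"
    proof (rule integrable_ranks_bounded)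
      have "(\<lambda>y. indicator {..<s} (y v) - s :: real) \<in> borel_measurable (ranks V)" if "v \<in> W" for v
      proof -
        have "(\<lambda>y. y v) \<in> borel_measurable (ranks V)" using that assms by (intro borel_measurable_rank) auto
        then show ?thesis by measurable
      qed
      then show "d l \<in> borel_measurable (ranks V)"
        unfolding deq[abs_def] by (intro borel_measurable_divide borel_measurable_abs borel_measurable_sum) auto
      fix y
      have "card {v \<in> W. y v < s} \<le> card W" using finW by (intro card_mono) auto
      then have "card {v \<in> W. y v < s} / card W \<le> 1" using c0 by simp
      then have "card {v \<in> W. y v < s} / card W \<le> 1" "0 \<le> card {v \<in> W. y v < s} / card W" by auto
      then show "\<bar>d l y\<bar> \<le> 1" using s unfolding d_def s_def[symmetric] by linarith
    qed
    have "(\<integral>y. d l y \<partial>ranks V) \<le> (\<integral>y. \<epsilon> + Q y / ((card W)\<^sup>2 * \<epsilon>) \<partial>ranks V)"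
      using di Q le by (intro integral_mono) auto
    also have "\<dots> = \<epsilon> + (\<integral>y. Q y \<partial>ranks V) / ((card W)\<^sup>2 * \<epsilon>)"
      using Q by (simp add: prob_space)
    also have "\<dots> \<le> \<epsilon> + card W / ((card W)\<^sup>2 * \<epsilon>)"
      using Q assms by (intro add_left_mono divide_right_mono) auto
    also have "\<dots> = \<epsilon> + 1 / (card W * \<epsilon>)" using c0 by (simp add: power2_eq_square)
    finally show ?thesis using di by simp
  qed
  have eq: "grid_deviation W L = (\<lambda>y. 1 / L + (\<Sum>l\<le>L. d l y))"
    by (simp add: grid_deviation_def[abs_def] d_def)
  have "(\<integral>y. 1 / L + (\<Sum>l\<le>L. d l y) \<partial>ranks V) = 1 / L + (\<Sum>l\<le>L. \<integral>y. d l y \<partial>ranks V)"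
    using d by (subst Bochner_Integration.integral_add) (auto simp: prob_space)
  also have "(\<Sum>l\<le>L. \<integral>y. d l y \<partial>ranks V) \<le> (\<Sum>l\<le>L. \<epsilon> + 1 / (card W * \<epsilon>))"
    using d by (intro sum_mono) auto
  finally have "(\<integral>y. grid_deviation W L y \<partial>ranks V) \<le> 1 / L + (real L + 1) * (\<epsilon> + 1 / (card W * \<epsilon>))"
    by (simp add: eq algebra_simps)
  moreover have "integrable (ranks V) (grid_deviation W L)"
    unfolding eq using d
    by (intro Bochner_Integration.integrable_add Bochner_Integration.integrable_sum) auto
  ultimately show ?thesis by (simp add: add.commute)
qed

lemma grid_deviation_approx:
  fixes \<theta> :: real and y :: "'v \<Rightarrow> real"
  assumes W: "finite W" "W \<noteq> {}" "S \<subseteq> W" and L: "L > 0"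
    and lt: "\<And>v. v \<in> W \<Longrightarrow> y v < \<theta> \<Longrightarrow> v \<in> S"
    and le: "\<And>v. v \<in> S \<Longrightarrow> y v \<le> \<theta>"
  shows "\<bar>measure unif {..<\<theta>} - card S / card W\<bar> \<le> grid_deviation W L y"
proof -
  define p where "p = measure unif {..<\<theta>}"
  have p: "p = max 0 (min \<theta> 1)" by (simp add: p_def measure_unif_lessThan)
  define c where "c l = card {v \<in> W. y v < real l / L} / card W" for l
  have c0: "card W > 0" using W by (simp add: card_gt_0_iff)
  have finS: "finite S" using W finite_subset by blast
  have dev: "\<bar>c l - l / L\<bar> + 1 / L \<le> grid_deviation W L y" if "l \<le> L" for l
    unfolding grid_deviation_def c_def
    using that member_le_sum[of l "{..L}" "\<lambda>l. \<bar>card {v \<in> W. y v < real l / L} / card W - real l / L\<bar>"]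
    by simp
  define l where "l = nat \<lfloor>p * L\<rfloor>"
  have "p * L \<ge> 0" using p by simp
  then have l: "l \<le> p * L" "p * L < l + 1" unfolding l_def by linarith+
  then have l': "l / L \<le> p" "p < (l + 1) / L" using L by (auto simp: field_simps)
  have "p * real L \<le> 1 * real L" using p by (intro mult_right_mono) auto
  then have "l \<le> L" using l by simp
  have "p - grid_deviation W L y \<le> card S / card W"
  proof (cases "l = 0")
    case True
    then have "p < 1 / L" using l' by simp
    moreover have "0 \<le> card S / card W" by simp
    ultimately show ?thesis using dev[of 0] by linarith
  next
    case False
    then have "0 < real l / L" using L by simp
    then have "p > 0" using l' by linarith
    then have "l / L \<le> \<theta>" using p l' by auto
    then have "card {v \<in> W. y v < real l / L} \<le> card S"
      using lt finS by (intro card_mono) force+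
    then have "c l \<le> card S / card W" unfolding c_def by (simp add: divide_right_mono)
    moreover have "l / L + 1 / L > p" using l' by (simp add: add_divide_distrib)
    ultimately show ?thesis using dev[OF \<open>l \<le> L\<close>] by linarith
  qed
  moreover have "card S / card W \<le> p + grid_deviation W L y"
  proof (cases "l = L")
    case True
    then have "p \<ge> 1" using l' L by simp
    moreover have "card S \<le> card W" using W by (intro card_mono) auto
    then have "card S / card W \<le> 1" using c0 by simp
    moreover have "0 \<le> 1 / real L" by simp
    then have "grid_deviation W L y \<ge> 0" using dev[of 0] by linarith
    ultimately show ?thesis by linarith
  next
    case False
    then have lL: "l + 1 \<le> L" using \<open>l \<le> L\<close> by simp
    then have "(l + 1) / L \<le> 1" using L by simp
    then have "\<theta> < (l + 1) / L" using l' p by (auto simp: max_def min_def split: if_splits)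
    then have "card S \<le> card {v \<in> W. y v < real (l + 1) / L}"
      using le W by (intro card_mono) force+
    then have "card S / card W \<le> c (l + 1)" unfolding c_def by (simp add: divide_right_mono)
    moreover have "real (l + 1) / L \<le> p + 1 / L" using l' by (simp add: add_divide_distrib)
    ultimately show ?thesis using dev[OF lL] by linarith
  qed
  ultimately show ?thesis by (simp add: p_def[symmetric] abs_le_iff)
qed

section \<open>The layered instance\<close>

lemma arg_min_on_cong:
  assumes "A = B" "\<And>u v. u \<in> A \<Longrightarrow> v \<in> A \<Longrightarrow> y u < y v \<longleftrightarrow> z u < z v"
  shows "arg_min_on y A = arg_min_on z B"
  unfolding arg_min_on_def arg_min_def is_arg_min_def
  using assms by (intro arg_cong[where f = Eps] ext) blast

lemma before_append: "a \<in> set xs \<Longrightarrow> b \<in> set ys \<Longrightarrow> before (xs @ ys) a b"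
proof -
  assume "a \<in> set xs" "b \<in> set ys"
  then obtain i j where "i < length xs" "xs ! i = a" "j < length ys" "ys ! j = b"
    by (metis in_set_conv_nth)
  then show ?thesis unfolding before_def
    by (intro exI[of _ i] exI[of _ "length xs + j"]) (auto simp: nth_append)
qed

locale layered =
  fixes n K :: nat
  assumes n_pos: "n > 0"
begin

definition N :: nat where "N = n * K"

definition pool :: "nat \<Rightarrow> nat set" where
  "pool m = {j. j < N \<and> j div n = Suc (m div n)}"

text \<open>
  The pool vertex with index \<open>m\<close> is \<open>2 * m\<close>, on level \<open>m div n\<close>; its private partner is \<open>2 * m + 1\<close>.
\<close>

definition inst :: "nat fo_instance" where
  "inst = \<lparr>verts = {..<2 * N},
     edges = {{2 * m, 2 * m + 1} | m. m < N} \<union> {{2 * m, 2 * j} | m j. m < N \<and> j \<in> pool m},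
     timeline = map Arrival [0..<2 * N] @
       map (\<lambda>m. Deadline (2 * m)) [0..<N] @ map (\<lambda>m. Deadline (2 * m + 1)) [0..<N]\<rparr>"

text \<open>
  Ranking on this instance only has to remember which pool vertices were matched passively: those
  with an earlier deadline are all matched, and private partners never take part again.
\<close>

primrec chosen :: "(nat \<Rightarrow> real) \<Rightarrow> nat \<Rightarrow> nat set" where
  "chosen y 0 = {}"
| "chosen y (Suc m) =
     (let S = chosen y m;
          v = arg_min_on y (insert (2 * m + 1) ((*) 2 ` (pool m - S)))
      in if m \<in> S \<or> odd v then S else insert (v div 2) S)"

declare chosen.simps(2) [simp del]

lemma inst_simps [simp]:
  "verts inst = {..<2 * N}"
  "timeline inst = map Arrival [0..<2 * N] @
     (map (\<lambda>m. Deadline (2 * m)) [0..<N] @ map (\<lambda>m. Deadline (2 * m + 1)) [0..<N])"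
  by (simp_all add: inst_def)

lemma finite_pool [simp]: "finite (pool m)"
  by (rule finite_subset[of _ "{..<N}"]) (auto simp: pool_def)

lemma pool_gt: "j \<in> pool m \<Longrightarrow> m < j"
  using div_le_mono[of j m n] by (cases "j \<le> m") (auto simp: pool_def)

lemma choice_in:
  fixes y :: "nat \<Rightarrow> real"
  shows "arg_min_on y (insert (2 * m + 1) ((*) 2 ` (pool m - S))) \<in> insert (2 * m + 1) ((*) 2 ` (pool m - S))"
  by (rule arg_min_if_finite) auto

lemma choice_le:
  fixes y :: "nat \<Rightarrow> real"
  assumes "v \<in> insert (2 * m + 1) ((*) 2 ` (pool m - S))"
  shows "y (arg_min_on y (insert (2 * m + 1) ((*) 2 ` (pool m - S)))) \<le> y v"
  using arg_min_if_finite(2)[of "insert (2 * m + 1) ((*) 2 ` (pool m - S))" y] assms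
  by (meson finite_imageI finite_insert finite_Diff finite_pool insert_not_empty not_le)

lemma chosen_step:
  obtains "chosen y (Suc m) = chosen y m"
  | j where "m \<notin> chosen y m" "j \<in> pool m - chosen y m" "chosen y (Suc m) = insert j (chosen y m)"
      "\<And>i. i \<in> pool m - chosen y m \<Longrightarrow> y (2 * j) \<le> y (2 * i)"
proof -
  let ?S = "chosen y m"
  let ?v = "arg_min_on y (insert (2 * m + 1) ((*) 2 ` (pool m - ?S)))"
  show ?thesis
  proof (cases "m \<in> ?S \<or> odd ?v")
    case True
    then show ?thesis by (intro that(1)) (simp add: Let_def chosen.simps(2))
  next
    case False
    then obtain j where j: "j \<in> pool m - ?S" "?v = 2 * j" using choice_in[of y m ?S] by auto
    show ?thesis
    proof (rule that(2)[OF _ j(1)])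
      fix i assume "i \<in> pool m - ?S"
      then show "y (2 * j) \<le> y (2 * i)" using choice_le[of "2 * i" m ?S y] j(2) by auto
    qed (use False j in \<open>auto simp: Let_def chosen.simps(2)\<close>)
  qed
qed

lemma chosen_cong:
  assumes "m \<le> N"
    and "\<And>u v. \<lbrakk>u < 2 * N; v < 2 * N; even u \<or> u < 2 * m; even v \<or> v < 2 * m\<rbrakk>
      \<Longrightarrow> y u < y v \<longleftrightarrow> z u < z v"
  shows "chosen y m = chosen z m"
  using assms
proof (induction m)
  case (Suc m)
  have S: "chosen y m = chosen z m"
  proof (rule Suc.IH)
    fix u v assume "u < 2 * N" "v < 2 * N" "even u \<or> u < 2 * m" "even v \<or> v < 2 * m"
    then show "y u < y v \<longleftrightarrow> z u < z v" by (intro Suc.prems(2)) auto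
  qed (use Suc.prems in simp)
  have "arg_min_on y (insert (2 * m + 1) ((*) 2 ` (pool m - chosen y m)))
      = arg_min_on z (insert (2 * m + 1) ((*) 2 ` (pool m - chosen z m)))"
    using Suc.prems by (intro arg_min_on_cong) (auto simp: S pool_def)
  then show ?case using S by (simp add: Let_def chosen.simps(2))
qed simp

lemma chosen_subset: "chosen y m \<subseteq> {..<N}"
proof (induction m)
  case (Suc m)
  show ?case by (rule chosen_step[of y m]) (use Suc in \<open>auto simp: pool_def\<close>)
qed simp

lemma finite_chosen [simp]: "finite (chosen y m)"
  using chosen_subset finite_subset by blast

lemma chosen_mono: "m \<le> m' \<Longrightarrow> chosen y m \<subseteq> chosen y m'"
proof (induction rule: dec_induct)
  case (step m')
  show ?case by (rule chosen_step[of y m']) (use step in auto)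
qed simp

lemma chosen_stable:
  assumes "m \<le> m'" "j div n \<le> m div n"
  shows "j \<in> chosen y m' \<longleftrightarrow> j \<in> chosen y m"
  using assms(1)
proof (induction rule: dec_induct)
  case (step m')
  have "j \<notin> pool m'"
    using assms(2) div_le_mono[OF step(1), of n] by (auto simp: pool_def)
  then have "j \<in> chosen y (Suc m') \<longleftrightarrow> j \<in> chosen y m'"
    by (rule_tac chosen_step[of y m']) auto
  then show ?case using step by blast
qed simp

lemma chosen_level: "j \<in> chosen y m \<Longrightarrow> \<exists>i<m. j \<in> pool i"
proof (induction m)
  case (Suc m)
  have "j \<in> chosen y m \<or> j \<in> pool m"
    by (rule chosen_step[of y m]) (use Suc.prems in auto)
  then show ?case using Suc.IH less_SucI by blast
qed simp

lemma chosen_smallest: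
  assumes "i \<in> chosen y m" "j \<notin> chosen y m" "i div n = j div n" "j < N"
  shows "y (2 * i) \<le> y (2 * j)"
  using assms
proof (induction m)
  case (Suc m)
  show ?case
  proof (rule chosen_step[of y m])
    fix j' assume j': "j' \<in> pool m - chosen y m" "chosen y (Suc m) = insert j' (chosen y m)"
      "\<And>i. i \<in> pool m - chosen y m \<Longrightarrow> y (2 * j') \<le> y (2 * i)"
    show ?thesis
    proof (cases "i = j'")
      case True
      then have "j \<in> pool m - chosen y m" using j' Suc.prems by (auto simp: pool_def)
      then show ?thesis using j' True by blast
    qed (use j' Suc in auto)
  qed (use Suc in auto)
qed simp

lemma neighbours_even:
  assumes "m < N"
  shows "neighbours inst (2 * m) = insert (2 * m + 1) ((*) 2 ` (pool m \<union> {j. j < N \<and> m \<in> pool j}))"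
    (is "?L = ?R")
proof
  show "?L \<subseteq> ?R"
    by (auto simp: neighbours_def inst_def doubleton_eq_iff) presburger+
  show "?R \<subseteq> ?L"
    using assms by (auto simp: neighbours_def inst_def doubleton_eq_iff)
qed

lemma neighbours_odd:
  assumes "m < N"
  shows "neighbours inst (2 * m + 1) = {2 * m}"
proof -
  have "Suc (2 * m) \<noteq> 2 * j" for j by presburger
  then show ?thesis
    using assms by (auto simp: neighbours_def inst_def doubleton_eq_iff)
qed

lemma ranking_even_deadlines:
  fixes y :: "nat \<Rightarrow> real"
  assumes "m \<le> N"
  defines "M \<equiv> foldl (ranking_step inst y) {} (map (\<lambda>m. Deadline (2 * m)) [0..<m])"
  shows "(\<forall>j. 2 * j \<in> \<Union>M \<longleftrightarrow> j < m \<or> j \<in> chosen y m) \<and> (\<forall>j. 2 * j + 1 \<in> \<Union>M \<longrightarrow> j < m) \<and>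
    finite M \<and> card M + card (chosen y m \<inter> {..<m}) = m"
  using assms(1) unfolding M_def
proof (induction m)
  case (Suc m)
  let ?S = "chosen y m"
  define M where "M = foldl (ranking_step inst y) {} (map (\<lambda>m. Deadline (2 * m)) [0..<m])"
  have IH: "\<And>j. 2 * j \<in> \<Union>M \<longleftrightarrow> j < m \<or> j \<in> ?S" "\<And>j. 2 * j + 1 \<in> \<Union>M \<longrightarrow> j < m"
    "finite M" "card M + card (?S \<inter> {..<m}) = m"
    using Suc unfolding M_def by auto
  define A where "A = neighbours inst (2 * m) - \<Union>M"
  have A: "A = insert (2 * m + 1) ((*) 2 ` (pool m - ?S))"
  proof -
    have "2 * m + 1 \<notin> \<Union>M" using IH(2)[of m] by auto
    moreover have "2 * j \<in> \<Union>M" if "m \<in> pool j" for j using IH(1) pool_gt[OF that] by blast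
    moreover have "2 * j \<in> \<Union>M \<longleftrightarrow> j \<in> ?S" if "j \<in> pool m" for j
      using IH(1) pool_gt[OF that] by auto
    ultimately show ?thesis
      unfolding A_def neighbours_even[OF Suc_le_lessD[OF Suc.prems]] by auto
  qed
  define v where "v = arg_min_on y A"
  have fold: "foldl (ranking_step inst y) {} (map (\<lambda>m. Deadline (2 * m)) [0..<Suc m])
      = ranking_step inst y M (Deadline (2 * m))" by (simp add: M_def)
  show ?case
  proof (cases "m \<in> ?S")
    case True
    then have "2 * m \<in> \<Union>M" using IH(1) by blast
    then have "ranking_step inst y M (Deadline (2 * m)) = M" by (simp add: Let_def)
    moreover have "chosen y (Suc m) = ?S" using True by (simp add: Let_def chosen.simps(2))
    moreover have "?S \<inter> {..<Suc m} = insert m (?S \<inter> {..<m})" using True by auto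
    ultimately show ?thesis using IH True unfolding fold by (auto simp: less_Suc_eq)
  next
    case False
    then have "2 * m \<notin> \<Union>M" using IH(1) by blast
    then have step: "ranking_step inst y M (Deadline (2 * m)) = insert {2 * m, v} M"
      unfolding ranking_step.simps A_def[symmetric] v_def Let_def A by simp
    have new: "{2 * m, v} \<notin> M" using \<open>2 * m \<notin> \<Union>M\<close> by auto
    have vA: "v \<in> insert (2 * m + 1) ((*) 2 ` (pool m - ?S))" using choice_in v_def A by auto
    have pas: "chosen y (Suc m) = (if odd v then ?S else insert (v div 2) ?S)"
      using False by (simp add: Let_def v_def A chosen.simps(2))
    have "chosen y (Suc m) \<inter> {..<Suc m} = ?S \<inter> {..<m}"
      using False vA pool_gt[of "v div 2" m] by (auto simp: pas less_Suc_eq)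
    moreover have "2 * j \<in> \<Union>(insert {2 * m, v} M) \<longleftrightarrow> j < Suc m \<or> j \<in> chosen y (Suc m)" for j
    proof -
      have "2 * j \<in> \<Union>(insert {2 * m, v} M) \<longleftrightarrow> j = m \<or> v = 2 * j \<or> 2 * j \<in> \<Union>M"
        by fastforce
      moreover have "j \<in> chosen y (Suc m) \<longleftrightarrow> v = 2 * j \<or> j \<in> ?S"
        by (auto simp: pas)
      ultimately show ?thesis using IH(1)[of j] less_Suc_eq by blast
    qed
    moreover have "2 * j + 1 \<in> \<Union>(insert {2 * m, v} M) \<longrightarrow> j < Suc m" for j
    proof -
      have "2 * j + 1 \<noteq> 2 * i" for i by presburger
      then show ?thesis using IH(2)[of j] vA by auto
    qed
    ultimately show ?thesis using IH(3,4) new unfolding fold step by simp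
  qed
qed simp

lemma card_ranking: "card (ranking inst y) + card (chosen y N) = N"
proof -
  define M where "M = foldl (ranking_step inst y) {} (map (\<lambda>m. Deadline (2 * m)) [0..<N])"
  have M: "\<And>j. j < N \<Longrightarrow> 2 * j \<in> \<Union>M" "card M + card (chosen y N \<inter> {..<N}) = N"
    using ranking_even_deadlines[of N y] by (auto simp: M_def)
  have arrivals: "foldl (ranking_step inst y) M' (map Arrival xs) = M'" for M' xs
    by (induction xs) auto
  have "foldl (ranking_step inst y) M (map (\<lambda>m. Deadline (2 * m + 1)) xs) = M"
    if "set xs \<subseteq> {..<N}" for xs
    using that
  proof (induction xs)
    case (Cons m xs)
    then have "neighbours inst (2 * m + 1) - \<Union>M = {}" using M(1) by (subst neighbours_odd) auto
    then show ?case using Cons by (simp add: Let_def)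
  qed simp
  then have "foldl (ranking_step inst y) M (map (\<lambda>m. Deadline (2 * m + 1)) [0..<N]) = M"
    by (metis atLeast_upt order_refl)
  then have "ranking inst y = M"
    by (simp only: ranking_def inst_simps foldl_append arrivals M_def[symmetric])
  moreover have "chosen y N \<inter> {..<N} = chosen y N" using chosen_subset by auto
  ultimately show ?thesis using M(2) by simp
qed

lemma inst_valid: "fully_online_instance inst"
proof -
  let ?xs = "map Arrival [0..<2 * N]"
  let ?ys = "map (\<lambda>m. Deadline (2 * m)) [0..<N] @ map (\<lambda>m. Deadline (2 * m + 1)) [0..<N]"
  have t: "timeline inst = ?xs @ ?ys" by (rule inst_simps)
  have ys: "set ?ys = Deadline ` {..<2 * N}"
  proof
    show "Deadline ` {..<2 * N} \<subseteq> set ?ys"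
    proof
      fix e assume "e \<in> Deadline ` {..<2 * N}"
      then obtain v where v: "e = Deadline v" "v < 2 * N" by auto
      obtain m where "v = 2 * m \<or> v = 2 * m + 1" by (metis oddE evenE)
      then show "e \<in> set ?ys" using v by auto
    qed
  qed auto
  have sub: "\<forall>e\<in>edges inst. \<exists>u\<in>verts inst. \<exists>v\<in>verts inst. u \<noteq> v \<and> e = {u, v}"
  proof
    fix e assume "e \<in> edges inst"
    then consider m where "m < N" "e = {2 * m, 2 * m + 1}"
      | m j where "m < N" "j \<in> pool m" "e = {2 * m, 2 * j}"
      by (auto simp: inst_def)
    then show "\<exists>u\<in>verts inst. \<exists>v\<in>verts inst. u \<noteq> v \<and> e = {u, v}"
    proof cases
      case 1
      then show ?thesis by (intro bexI[of _ "2 * m"] bexI[of _ "2 * m + 1"]) auto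
    next
      case 2
      then show ?thesis using pool_gt[OF 2(2)]
        by (intro bexI[of _ "2 * m"] bexI[of _ "2 * j"]) (auto simp: pool_def)
    qed
  qed
  have nb: "neighbours inst v \<subseteq> verts inst" for v
  proof
    fix u assume "u \<in> neighbours inst v"
    then have "{u, v} \<in> edges inst" by (simp add: neighbours_def)
    with sub obtain a b where "a \<in> verts inst" "b \<in> verts inst" "{u, v} = {a, b}" by blast
    then show "u \<in> verts inst" by (auto simp only: doubleton_eq_iff)
  qed
  have "Suc (2 * a) \<noteq> 2 * b" "2 * b \<noteq> Suc (2 * a)" for a b :: nat by presburger+
  then have "distinct (timeline inst)"
    unfolding t by (auto simp: distinct_map inj_on_def)
  moreover have "set (timeline inst) = Arrival ` verts inst \<union> Deadline ` verts inst"
    unfolding t set_append ys[unfolded set_append] by (auto simp: atLeast0LessThan)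
  moreover have "before (timeline inst) (Arrival u) (Deadline v)"
    if "v \<in> verts inst" "u \<in> insert v (neighbours inst v)" for u v
  proof -
    have "u < 2 * N" using that nb[of v] by auto
    then show ?thesis unfolding t
      by (rule_tac before_append) (use that ys in auto)
  qed
  ultimately show ?thesis using sub by (simp add: fully_online_instance_def)
qed

lemma inst_bipartite: "bipartite inst"
proof -
  define side where "side v = even (v + v div 2 div n)" for v
  have "\<exists>u\<in>{v. v < 2 * N \<and> side v}. \<exists>v\<in>{v. v < 2 * N \<and> \<not> side v}. e = {u, v}"
    if "e \<in> edges inst" for e
  proof -
    have *: ?thesis if "u < 2 * N" "v < 2 * N" "e = {u, v}" "side u \<noteq> side v" for u v
      using that by (cases "side u") (auto simp: insert_commute)
    from that consider m where "m < N" "e = {2 * m, 2 * m + 1}"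
      | m j where "m < N" "j \<in> pool m" "e = {2 * m, 2 * j}"
      unfolding inst_def by auto
    then show ?thesis
    proof cases
      case 1
      then show ?thesis by (intro *[of "2 * m" "2 * m + 1"]) (auto simp: side_def)
    next
      case 2
      then show ?thesis by (intro *[of "2 * m" "2 * j"]) (auto simp: side_def pool_def)
    qed
  qed
  then show ?thesis unfolding bipartite_def
    by (intro exI[of _ "{v. v < 2 * N \<and> side v}"] exI[of _ "{v. v < 2 * N \<and> \<not> side v}"]) auto
qed

lemma opt_ge: "N \<le> opt inst"
proof -
  let ?f = "\<lambda>m::nat. {2 * m, 2 * m + 1}"
  have parity: "Suc (2 * a) \<noteq> 2 * b" "2 * b \<noteq> Suc (2 * a)" for a b :: nat by presburger+
  have d: "?f a \<inter> ?f b = {}" if "a \<noteq> b" for a b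
    using that parity by auto
  have "?f ` {..<N} \<subseteq> edges inst" by (auto simp: inst_def)
  moreover have "pairwise disjnt (?f ` {..<N})"
  proof (rule pairwiseI)
    fix e e' assume "e \<in> ?f ` {..<N}" "e' \<in> ?f ` {..<N}" "e \<noteq> e'"
    then obtain a b where "e = ?f a" "e' = ?f b" "a \<noteq> b" by blast
    then show "disjnt e e'" using d[of a b] by (simp add: disjnt_def)
  qed
  ultimately have "is_matching inst (?f ` {..<N})" by (simp add: is_matching_def)
  then have "card (?f ` {..<N}) \<le> opt inst"
    unfolding opt_def using finite_matchings[OF inst_valid] by (intro Max_ge) auto
  moreover have "inj_on ?f {..<N}"
    by (rule inj_onI) (metis d Int_absorb insert_not_empty)
  ultimately show ?thesis by (simp add: card_image)
qed

end

section \<open>One level of the fluid limit\<close>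

lemma drift_bound:
  fixes D \<rho> p \<delta> h :: real
  assumes "0 \<le> p" "p \<le> 1" "0 \<le> \<rho>" "\<rho> \<le> 1" "0 \<le> h" "\<bar>D\<bar> \<le> 1" "\<bar>p - (1 - (D + \<rho>))\<bar> \<le> \<delta>"
  shows "(D + h * \<rho> - h)\<^sup>2 + ((D + h * \<rho>)\<^sup>2 - (D + h * \<rho> - h)\<^sup>2) * p \<le> D\<^sup>2 + 2 * h * \<delta> + h\<^sup>2"
proof -
  define e where "e = p - (1 - (D + \<rho>))"
  have "D * e \<le> \<bar>D\<bar> * \<bar>e\<bar>" by (metis abs_ge_self abs_mult)
  also have "\<dots> \<le> 1 * \<delta>" using assms e_def by (intro mult_mono) auto
  finally have 1: "h * (D * e) \<le> h * \<delta>" using assms by (intro mult_left_mono) auto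
  have "p * \<rho>\<^sup>2 + (1 - p) * (1 - \<rho>)\<^sup>2 \<le> p * 1 + (1 - p) * 1"
    using assms by (intro add_mono mult_left_mono) (auto simp: power_le_one)
  then have 2: "h\<^sup>2 * (p * \<rho>\<^sup>2 + (1 - p) * (1 - \<rho>)\<^sup>2) \<le> h\<^sup>2 * 1"
    by (intro mult_left_mono) auto
  have 3: "0 \<le> h * D\<^sup>2" using assms by simp
  have "(D + h * \<rho> - h)\<^sup>2 + ((D + h * \<rho>)\<^sup>2 - (D + h * \<rho> - h)\<^sup>2) * p
      = D\<^sup>2 + 2 * (h * (D * e)) - 2 * (h * D\<^sup>2) + h\<^sup>2 * (p * \<rho>\<^sup>2 + (1 - p) * (1 - \<rho>)\<^sup>2)"
    unfolding e_def by (simp add: power2_eq_square algebra_simps)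
  then show ?thesis using 1 2 3 by linarith
qed

lemma power_one_minus_inverse_approx:
  assumes "n > 0" "c \<le> n"
  shows "\<bar>(1 - 1 / real n) ^ c - exp (- (real c / real n))\<bar> \<le> 1 / real n"
proof -
  define h where "h = 1 / real n"
  have h: "0 < h" "h \<le> 1" using assms by (auto simp: h_def)
  have "1 - h \<le> exp (- h)" using exp_ge_add_one_self[of "-h"] by simp
  moreover have "exp (- h) \<le> 1 - h + h\<^sup>2"
  proof -
    have "1 \<le> 1 + h ^ 3" using h by simp
    also have "\<dots> = (1 - h + h\<^sup>2) * (1 + h)" by (simp add: algebra_simps power2_eq_square power3_eq_cube)
    also have "\<dots> \<le> (1 - h + h\<^sup>2) * exp h"
      using h exp_ge_add_one_self[of h] by (intro mult_left_mono) auto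
    finally show ?thesis by (simp add: exp_minus field_simps)
  qed
  ultimately have d: "\<bar>(1 - h) - exp (- h)\<bar> \<le> h\<^sup>2" by auto
  have "\<bar>(1 - h) ^ c - exp (- h) ^ c\<bar> \<le> c * \<bar>(1 - h) - exp (- h)\<bar>"
    using norm_power_diff[of "1 - h" "exp (- h)" c] h by simp
  also have "\<dots> \<le> n * h\<^sup>2" using d assms by (intro mult_mono) auto
  also have "\<dots> = h" using assms by (simp add: h_def power2_eq_square)
  finally show ?thesis by (simp add: h_def exp_of_nat_mult[symmetric])
qed

context layered
begin

definition level :: "nat \<Rightarrow> nat set" where
  "level k = {k * n..<k * n + n}"

lemma level_iff: "j \<in> level k \<longleftrightarrow> j div n = k"
proof
  assume "j \<in> level k"
  then show "j div n = k" by (auto simp: level_def algebra_simps intro!: div_nat_eqI)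
next
  assume "j div n = k"
  then have "k * n + j mod n = j" using div_mult_mod_eq[of j n] by simp
  moreover have "j mod n < n" using n_pos by simp
  ultimately show "j \<in> level k" unfolding level_def atLeastLessThan_iff by linarith
qed

lemma finite_level [simp]: "finite (level k)" and card_level [simp]: "card (level k) = n"
  by (simp_all add: level_def)

lemma level_subset: "k < K \<Longrightarrow> level k \<subseteq> {..<N}"
proof -
  assume "k < K"
  then have "Suc k * n \<le> K * n" by (intro mult_le_mono1) auto
  then show ?thesis by (auto simp: level_def N_def mult.commute)
qed

lemma pool_level: "Suc k < K \<Longrightarrow> m \<in> level k \<Longrightarrow> pool m = level (Suc k)"
  using level_subset[of "Suc k"] by (auto simp: pool_def level_iff)

lemma level_offset: "i < n \<Longrightarrow> k * n + i \<in> level k"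
  by (simp add: level_def)

definition act :: "nat \<Rightarrow> (nat \<Rightarrow> real) \<Rightarrow> real" where
  "act k y = card (level k - chosen y (k * n)) / n"

definition used :: "nat \<Rightarrow> nat \<Rightarrow> (nat \<Rightarrow> real) \<Rightarrow> nat" where
  "used k i y = card ({k * n..<k * n + i} - chosen y (k * n))"

text \<open>
  Compares the surviving fraction of the next level with its fluid limit: each active deadline
  removes, in expectation, a fraction \<open>1 / n\<close> of what is left.
\<close>

definition err :: "nat \<Rightarrow> nat \<Rightarrow> (nat \<Rightarrow> real) \<Rightarrow> real" where
  "err k i y = card (level (Suc k) - chosen y (k * n + i)) / n - (1 - 1 / n) ^ used k i y"

lemma chosen_level_stable:
  assumes "j \<in> level k" "k * n \<le> m" "k * n \<le> m'"
  shows "j \<in> chosen y m \<longleftrightarrow> j \<in> chosen y m'"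
  using chosen_stable[of "k * n" m j y] chosen_stable[of "k * n" m' j y] assms n_pos
  by (simp add: level_iff)

lemma chosen_future_level: "chosen y (k * n) \<inter> level (Suc k) = {}"
proof -
  have False if j: "j \<in> chosen y (k * n)" "j div n = Suc k" for j
  proof -
    obtain i where i: "i < k * n" "j \<in> pool i" using chosen_level[OF j(1)] by blast
    then have "i div n < k" using n_pos by (simp add: less_mult_imp_div_less)
    then show False using i j by (simp add: pool_def)
  qed
  then show ?thesis by (auto simp: level_iff)
qed

lemma fraction_bounds: "0 \<le> card (level k - S) / real n" "card (level k - S) / real n \<le> 1"
proof -
  have "card (level k - S) \<le> card (level k)" by (intro card_mono) auto
  then show "0 \<le> card (level k - S) / real n" "card (level k - S) / real n \<le> 1" using n_pos by auto
qed

lemma act_bounds: "0 \<le> act k y" "act k y \<le> 1"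
  unfolding act_def by (fact fraction_bounds)+

lemma power_bounds: "0 \<le> (1 - 1 / real n) ^ c" "(1 - 1 / real n) ^ c \<le> 1"
  using n_pos by (auto intro: power_le_one)

lemma err_bound: "\<bar>err k i y\<bar> \<le> 1"
  using fraction_bounds[of "Suc k" "chosen y (k * n + i)"] power_bounds[of "used k i y"]
  unfolding err_def by linarith

lemma used_bound: "i \<le> n \<Longrightarrow> used k i y \<le> n"
  using card_mono[of "{k * n..<k * n + i}" "{k * n..<k * n + i} - chosen y (k * n)"]
  by (simp add: used_def)

lemma act_eq_used: "act k y = used k n y / n"
  by (simp add: act_def used_def level_def)

lemma act_0: "act 0 y = 1"
  using n_pos by (simp add: act_def)

lemma err_0: "err k 0 y = 0"
proof -
  have "level (Suc k) - chosen y (k * n) = level (Suc k)" using chosen_future_level by blast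
  then show ?thesis using n_pos by (simp add: err_def used_def)
qed

lemma err_n: "err k n y = act (Suc k) y - (1 - 1 / n) ^ used k n y"
  by (simp add: err_def act_def add.commute)

lemma card_ranking_eq_sum_act: "card (ranking inst y) = n * (\<Sum>k<K. act k y)"
proof -
  have "card (ranking inst y) = N - card (chosen y N)" using card_ranking[of y] by simp
  also have "\<dots> = card ({..<N} - chosen y N)" using chosen_subset by (subst card_Diff_subset) auto
  also have "{..<N} - chosen y N = (\<Union>k<K. level k - chosen y (k * n))"
  proof (intro set_eqI iffI)
    fix j assume j: "j \<in> {..<N} - chosen y N"
    then have "j div n < K" by (simp add: N_def less_mult_imp_div_less mult.commute)
    moreover from this have "j div n * n \<le> N" by (simp add: N_def)
    then have "j \<notin> chosen y (j div n * n)" using j chosen_mono by blast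
    ultimately show "j \<in> (\<Union>k<K. level k - chosen y (k * n))" by (auto simp: level_iff)
  next
    fix j assume "j \<in> (\<Union>k<K. level k - chosen y (k * n))"
    then obtain k where k: "k < K" "j \<in> level k" "j \<notin> chosen y (k * n)" by blast
    have "k * n \<le> N" using k(1) by (simp add: N_def)
    then show "j \<in> {..<N} - chosen y N"
      using k level_subset[OF k(1)] chosen_level_stable[OF k(2), of "k * n" N y] by auto
  qed
  also have "card \<dots> = (\<Sum>k<K. card (level k - chosen y (k * n)))"
    by (intro card_UN_disjoint) (auto simp: level_iff)
  also have "real \<dots> = n * (\<Sum>k<K. act k y)"
    using n_pos by (simp add: act_def sum_distrib_left)
  finally show ?thesis by simp
qed

lemma borel_measurable_chosen:
  fixes f :: "(nat \<Rightarrow> real) \<Rightarrow> real"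
  assumes "\<And>y z. (\<And>m. m \<le> N \<Longrightarrow> chosen y m = chosen z m) \<Longrightarrow> f y = f z"
  shows "f \<in> borel_measurable (ranks {..<2 * N})"
  by (intro borel_measurable_ranks_order_invariant assms chosen_cong) auto

lemma offset_le: "k < K \<Longrightarrow> i \<le> n \<Longrightarrow> k * n + i \<le> N"
  using mult_le_mono1[of "Suc k" K n] by (simp add: N_def mult.commute)

lemma integrable_act: "k < K \<Longrightarrow> integrable (ranks {..<2 * N}) (act k)"
  using offset_le[of k 0] act_bounds[of k]
  by (intro integrable_ranks_bounded[where B = 1] borel_measurable_chosen) (auto simp: act_def abs_le_iff)

lemma borel_measurable_err:
  "k < K \<Longrightarrow> i \<le> n \<Longrightarrow> err k i \<in> borel_measurable (ranks {..<2 * N})"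
  using offset_le[of k 0] offset_le[of k i]
  by (intro borel_measurable_chosen) (simp add: err_def used_def)

lemma integrable_err_sq:
  assumes "k < K" "i \<le> n"
  shows "integrable (ranks {..<2 * N}) (\<lambda>y. (err k i y)\<^sup>2)"
proof (rule integrable_ranks_bounded[where B = 1])
  show "(\<lambda>y. (err k i y)\<^sup>2) \<in> borel_measurable (ranks {..<2 * N})"
    using borel_measurable_err[OF assms] by measurable
qed (simp add: abs_square_le_1 err_bound)

definition dev :: "nat \<Rightarrow> nat \<Rightarrow> (nat \<Rightarrow> real) \<Rightarrow> real" where
  "dev L k = grid_deviation ((*) 2 ` level (Suc k)) L"

lemma dev_nonneg: "0 \<le> dev L k y"
  unfolding dev_def grid_deviation_def by (intro add_nonneg_nonneg sum_nonneg) auto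

lemma integrable_dev:
  fixes \<epsilon> :: real
  assumes "Suc k < K" "L > 0" "\<epsilon> > 0"
  shows "integrable (ranks {..<2 * N}) (dev L k)" (is ?A)
    and "(\<integral>y. dev L k y \<partial>ranks {..<2 * N}) \<le> 1 / L + (real L + 1) * (\<epsilon> + 1 / (n * \<epsilon>))" (is ?B)
proof -
  have "inj_on ((*) (2::nat)) A" for A by (simp add: inj_on_def)
  then have c: "card ((*) 2 ` level (Suc k)) = n" by (simp add: card_image)
  have "(*) 2 ` level (Suc k) \<subseteq> {..<2 * N}" "(*) 2 ` level (Suc k) \<noteq> {}"
    using level_subset[OF assms(1)] n_pos by (auto simp: level_def)
  from expectation_grid_deviation[OF _ this assms(2,3)]
  show ?A ?B
    by (simp_all add: dev_def c add.commute)
qed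

lemma used_Suc:
  assumes "i < n"
  shows "used k (Suc i) y = (if k * n + i \<in> chosen y (k * n + i) then used k i y else Suc (used k i y))"
proof -
  have "k * n + i \<in> chosen y (k * n + i) \<longleftrightarrow> k * n + i \<in> chosen y (k * n)"
    by (intro chosen_level_stable[OF level_offset[OF assms]]) auto
  moreover have "{k * n..<k * n + Suc i} = insert (k * n + i) {k * n..<k * n + i}" by auto
  ultimately show ?thesis by (simp add: used_def insert_Diff_if)
qed

lemma drift:
  assumes k: "Suc k < K" and i: "i < n" and L: "L > 0"
  shows "0 \<le> (\<integral>y. (err k i y)\<^sup>2 + 2 / n * dev L k y + 1 / n\<^sup>2 - (err k (Suc i) y)\<^sup>2 \<partial>ranks {..<2 * N})"
proof (rule integral_ranks_coordinate_nonneg)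
  define m where "m = k * n + i"
  have m: "m < N" "m \<in> level k"
    using level_offset[OF i] level_subset[of k] k by (auto simp: m_def)
  have pool: "pool m = level (Suc k)" using pool_level k m by simp
  show "2 * m + 1 \<in> {..<2 * N}" using m by simp
  show "integrable (ranks {..<2 * N})
      (\<lambda>y. (err k i y)\<^sup>2 + 2 / n * dev L k y + 1 / n\<^sup>2 - (err k (Suc i) y)\<^sup>2)"
  proof -
    interpret prob_space "ranks {..<2 * N}" by (rule prob_space_ranks)
    show ?thesis
      using k i L integrable_dev(1)[of k L 1]
      by (intro Bochner_Integration.integrable_diff Bochner_Integration.integrable_add
          integrable_err_sq integrable_mult_right) auto
  qed
  fix x :: "nat \<Rightarrow> real"
  \<comment> \<open>Nothing decided before the deadline of \<open>2 * m\<close> depends on the rank \<open>t\<close> of its private partner.\<close>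
  define y where "y t = x(2 * m + 1 := t)" for t
  define S where "S = chosen x m"
  define D where "D = err k i x"
  define \<rho> where "\<rho> = (1 - 1 / real n) ^ used k i x"
  define \<delta> where "\<delta> = dev L k x"
  define A where "A = level (Suc k) - S"
  define E where "E t = (err k i (y t))\<^sup>2 + 2 / n * dev L k (y t) + 1 / n\<^sup>2 - (err k (Suc i) (y t))\<^sup>2" for t
  have \<rho>: "0 \<le> \<rho>" "\<rho> \<le> 1" unfolding \<rho>_def by (fact power_bounds)+
  have par: "2 * j \<noteq> Suc (2 * m)" for j by presburger
  have S_t: "chosen (y t) m' = chosen x m'" if "m' \<le> m" for t m'
    using that m by (intro chosen_cong) (auto simp: y_def)
  have used_t: "used k i (y t) = used k i x" for t
    using S_t[of "k * n"] by (simp add: used_def m_def)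
  have D_t: "err k i (y t) = D" for t
    using S_t[of m] used_t by (simp add: err_def D_def m_def)
  have \<delta>_t: "dev L k (y t) = \<delta>" for t
  proof -
    have "{v \<in> (*) 2 ` level (Suc k). y t v < s} = {v \<in> (*) 2 ` level (Suc k). x v < s}" for s
      by (auto simp: y_def par par[symmetric])
    then show ?thesis by (simp add: \<delta>_def dev_def grid_deviation_def)
  qed
  have E: "E t = D\<^sup>2 + 2 / n * \<delta> + 1 / n\<^sup>2 - (err k (Suc i) (y t))\<^sup>2" for t
    by (simp add: E_def D_t \<delta>_t)
  have D: "D = card A / n - \<rho>" by (simp add: D_def err_def \<rho>_def A_def S_def m_def)
  have err_S: "err k (Suc i) (y t) = card (level (Suc k) - chosen (y t) (Suc m)) / n
      - (if m \<in> S then \<rho> else (1 - 1 / n) * \<rho>)" for t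
    using used_Suc[OF i, of k "y t"] used_t[of t] S_t[of m t]
    by (simp add: err_def \<rho>_def S_def m_def)
  have \<delta>0: "0 \<le> \<delta>" by (simp add: \<delta>_def dev_nonneg)
  have "0 \<le> (\<integral>t. E t \<partial>unif)"
  proof (cases "m \<in> S \<or> A = {}")
    case True
    have "(err k (Suc i) (y t))\<^sup>2 \<le> D\<^sup>2" for t
    proof -
      have "chosen (y t) (Suc m) = S"
      proof (rule chosen_step[of "y t" m])
        assume "chosen (y t) (Suc m) = chosen (y t) m"
        then show ?thesis by (simp add: S_t S_def)
      qed (use True in \<open>auto simp: S_t S_def A_def pool\<close>)
      then have e: "err k (Suc i) (y t) = card A / n - (if m \<in> S then \<rho> else (1 - 1 / n) * \<rho>)"
        by (simp add: err_S A_def)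
      show ?thesis
      proof (cases "m \<in> S")
        case True
        then show ?thesis by (simp add: e D)
      next
        case False
        then have "A = {}" using \<open>m \<in> S \<or> A = {}\<close> by blast
        moreover have "((1 - 1 / n) * \<rho>)\<^sup>2 \<le> \<rho>\<^sup>2"
          using \<rho> n_pos by (intro power_mono mult_left_le_one_le) auto
        ultimately show ?thesis using False by (simp add: e D)
      qed
    qed
    then show ?thesis
      using \<delta>0 by (intro Bochner_Integration.integral_nonneg) (simp add: E add_increasing2)
  next
    case False
    then have mS: "m \<notin> S" and "A \<noteq> {}" by auto
    have finA: "finite A" by (simp add: A_def)
    define \<theta> where "\<theta> = Min ((\<lambda>j. x (2 * j)) ` A)"
    define p where "p = measure unif {..<\<theta>}"
    define h where "h = 1 / real n"
    have \<theta>_le: "\<theta> \<le> x (2 * j)" if "j \<in> A" for j unfolding \<theta>_def using that finA by auto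
    have "\<theta> \<in> (\<lambda>j. x (2 * j)) ` A" unfolding \<theta>_def using finA \<open>A \<noteq> {}\<close> by (intro Min_in) auto
    then obtain a where a: "a \<in> A" "\<theta> = x (2 * a)" by blast
    have "\<bar>p - card ((*) 2 ` (S \<inter> level (Suc k))) / card ((*) 2 ` level (Suc k))\<bar> \<le> \<delta>"
      unfolding p_def \<delta>_def dev_def
    proof (rule grid_deviation_approx)
      show "(*) 2 ` level (Suc k) \<noteq> {}" using n_pos by (auto simp: level_def)
    next
      fix v assume "v \<in> (*) 2 ` level (Suc k)" "x v < \<theta>"
      then show "v \<in> (*) 2 ` (S \<inter> level (Suc k))" using \<theta>_le by (force simp: A_def)
    next
      fix v assume "v \<in> (*) 2 ` (S \<inter> level (Suc k))"
      then obtain j where j: "v = 2 * j" "j \<in> S" "j \<in> level (Suc k)" by blast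
      show "x v \<le> \<theta>" unfolding j(1) a(2)
        by (rule chosen_smallest[of j x m])
          (use j a level_subset[OF k] in \<open>auto simp: S_def A_def level_iff\<close>)
    qed (use L in auto)
    moreover have "inj_on ((*) (2::nat)) X" for X by (simp add: inj_on_def)
    moreover have "card (S \<inter> level (Suc k)) + card A = n"
      using card_Int_Diff[of "level (Suc k)" S] by (simp add: A_def Int_commute)
    then have "card (S \<inter> level (Suc k)) / n = 1 - (D + \<rho>)"
      using n_pos by (simp add: D field_simps flip: of_nat_add)
    ultimately have approx: "\<bar>p - (1 - (D + \<rho>))\<bar> \<le> \<delta>" by (simp add: card_image)
    have lt: "err k (Suc i) (y t) = D + h * \<rho>" if "t < \<theta>" for t
    proof -
      have "chosen (y t) (Suc m) = S"
        unfolding chosen.simps(2) Let_def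
      proof (subst if_P)
        let ?B = "insert (2 * m + 1) ((*) 2 ` (pool m - chosen (y t) m))"
        have "y t (arg_min_on (y t) ?B) \<le> t"
          using choice_le[of "2 * m + 1" m "chosen (y t) m" "y t"] by (simp add: y_def)
        moreover have "t < y t v" if v: "v \<in> (*) 2 ` (pool m - chosen (y t) m)" for v
        proof -
          obtain j where j: "v = 2 * j" "j \<in> A"
            using v by (auto simp: pool S_t S_def A_def)
          then show ?thesis using \<theta>_le[of j] \<open>t < \<theta>\<close> by (simp add: y_def par)
        qed
        ultimately have "arg_min_on (y t) ?B = 2 * m + 1"
          using choice_in[of "y t" m "chosen (y t) m"] by (meson insertE not_le)
        then show "m \<in> chosen (y t) m \<or> odd (arg_min_on (y t) ?B)" by simp
      qed (simp add: S_t S_def)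
      then show ?thesis using mS by (simp add: err_S D A_def h_def algebra_simps)
    qed
    have gt: "err k (Suc i) (y t) = D + h * \<rho> - h" if "t > \<theta>" for t
    proof -
      let ?v = "arg_min_on (y t) (insert (2 * m + 1) ((*) 2 ` (pool m - chosen (y t) m)))"
      have "2 * a \<in> insert (2 * m + 1) ((*) 2 ` (pool m - chosen (y t) m))"
        using a by (auto simp: pool S_t S_def A_def)
      then have "y t ?v \<le> y t (2 * a)" by (rule choice_le)
      also have "\<dots> < t" using a that by (simp add: y_def par)
      finally have "?v \<noteq> 2 * m + 1" by (auto simp: y_def)
      then obtain j where j: "j \<in> A" "?v = 2 * j"
        using choice_in[of "y t" m "chosen (y t) m"] by (auto simp: pool S_t S_def A_def)
      have "chosen (y t) (Suc m) = insert j S"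
        using mS j(2) by (simp add: chosen.simps(2) Let_def S_t S_def)
      moreover have "level (Suc k) - insert j S = A - {j}" by (auto simp: A_def)
      moreover have "card A = Suc (card (A - {j}))" using j finA by (intro card.remove) auto
      ultimately show ?thesis using mS by (simp add: err_S D h_def algebra_simps add_divide_distrib)
    qed
    define c where "c = D\<^sup>2 + 2 / n * \<delta> + 1 / n\<^sup>2"
    define u where "u = (D + h * \<rho> - h)\<^sup>2"
    define w where "w = (D + h * \<rho>)\<^sup>2 - u"
    interpret U: prob_space unif by (rule prob_space_unif)
    have ind: "integrable unif (indicator {..<\<theta>} :: real \<Rightarrow> real)"
      by (rule U.integrable_const_bound[where B = 1]) (auto simp: indicator_def)
    have AE: "AE t in unif. E t = (c - u) - w * indicator {..<\<theta>} t"
      using AE_unif_neq[of \<theta>]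
    proof eventually_elim
      case (elim t)
      then consider "t < \<theta>" | "t > \<theta>" by linarith
      then show ?case by cases (simp_all add: E c_def w_def lt gt u_def)
    qed
    have "E \<in> borel_measurable unif"
    proof -
      have "E t = (if t < \<theta> then c - u - w else if t > \<theta> then c - u else E \<theta>)" for t
        by (cases t \<theta> rule: linorder_cases) (simp_all add: E c_def w_def lt gt u_def)
      then have "E = (\<lambda>t. if t < \<theta> then c - u - w else if t > \<theta> then c - u else E \<theta>)" by blast
      moreover have "(\<lambda>t. if t < \<theta> then c - u - w else if t > \<theta> then c - u else E \<theta>)
          \<in> borel_measurable unif" by measurable
      ultimately show ?thesis by simp
    qed
    then have "(\<integral>t. E t \<partial>unif) = (\<integral>t. (c - u) - w * indicator {..<\<theta>} t \<partial>unif)"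
      using AE by (intro integral_cong_AE) auto
    also have "\<dots> = (c - u) - w * p"
      using ind by (simp add: p_def U.prob_space)
    also have "\<dots> \<ge> 0"
    proof -
      have "0 \<le> p" "p \<le> 1" by (auto simp: p_def measure_unif_lessThan)
      then have "u + w * p \<le> D\<^sup>2 + 2 * h * \<delta> + h\<^sup>2"
        unfolding u_def w_def using approx \<rho> err_bound[of k i x]
        by (intro drift_bound) (auto simp: h_def D_def)
      then show ?thesis by (simp add: c_def h_def power_divide)
    qed
    finally show ?thesis .
  qed
  then show "0 \<le> (\<integral>t. (err k i (x(2 * m + 1 := t)))\<^sup>2 + 2 / n * dev L k (x(2 * m + 1 := t)) + 1 / n\<^sup>2
      - (err k (Suc i) (x(2 * m + 1 := t)))\<^sup>2 \<partial>unif)"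
    by (simp add: E_def y_def)
qed simp

end

section \<open>Iterating over the levels\<close>

primrec limit_act :: "nat \<Rightarrow> real" where
  "limit_act 0 = 1"
| "limit_act (Suc k) = exp (- limit_act k)"

lemma exp_minus_lipschitz:
  fixes x y b :: real
  assumes "b \<le> x" "b \<le> y"
  shows "\<bar>exp (- x) - exp (- y)\<bar> \<le> exp (- b) * \<bar>x - y\<bar>"
proof -
  have *: "exp (- x) - exp (- y) \<le> exp (- b) * (y - x)" if "b \<le> x" "x \<le> y" for x y
  proof -
    have "exp (- x) * (1 + (x - y)) \<le> exp (- x) * exp (x - y)"
      using exp_ge_add_one_self[of "x - y"] by (intro mult_left_mono) auto
    also have "\<dots> = exp (- y)" by (simp flip: exp_add)
    finally have "exp (- x) - exp (- y) \<le> exp (- x) * (y - x)" by (simp add: algebra_simps)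
    also have "\<dots> \<le> exp (- b) * (y - x)" using that by (intro mult_right_mono) auto
    finally show ?thesis .
  qed
  show ?thesis
  proof (cases "x \<le> y")
    case True
    then show ?thesis using *[of x y] assms by simp
  next
    case False
    then show ?thesis using *[of y x] assms by simp
  qed
qed

lemma limit_act_bounds: "exp (- 1) \<le> limit_act k \<and> limit_act k \<le> 1"
proof (induction k)
  case (Suc k)
  then have "0 \<le> limit_act k" by (meson exp_ge_zero order_trans)
  then show ?case using Suc by simp
qed simp

context layered
begin

lemma expectation_err_sq:
  fixes L :: nat and \<epsilon> :: real
  assumes "Suc k < K" "L > 0" "\<epsilon> > 0" "i \<le> n"
  shows "(\<integral>y. (err k i y)\<^sup>2 \<partial>ranks {..<2 * N})
    \<le> i * (2 / n * (1 / L + (real L + 1) * (\<epsilon> + 1 / (n * \<epsilon>))) + 1 / n\<^sup>2)"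
  using assms(4)
proof (induction i)
  case (Suc i)
  interpret prob_space "ranks {..<2 * N}" by (rule prob_space_ranks)
  have int: "integrable (ranks {..<2 * N}) (\<lambda>y. (err k i y)\<^sup>2)"
    "integrable (ranks {..<2 * N}) (\<lambda>y. (err k (Suc i) y)\<^sup>2)"
    using assms(1) Suc.prems by (auto intro!: integrable_err_sq)
  note dev = integrable_dev[OF assms(1-3)]
  have "0 \<le> (\<integral>y. (err k i y)\<^sup>2 + 2 / n * dev L k y + 1 / n\<^sup>2 - (err k (Suc i) y)\<^sup>2 \<partial>ranks {..<2 * N})"
    using Suc.prems assms by (intro drift) auto
  also have "\<dots> = (\<integral>y. (err k i y)\<^sup>2 \<partial>ranks {..<2 * N}) + 2 / n * (\<integral>y. dev L k y \<partial>ranks {..<2 * N})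
      + 1 / n\<^sup>2 - (\<integral>y. (err k (Suc i) y)\<^sup>2 \<partial>ranks {..<2 * N})"
    using int dev(1) by (simp add: prob_space)
  finally have "(\<integral>y. (err k (Suc i) y)\<^sup>2 \<partial>ranks {..<2 * N})
    \<le> (\<integral>y. (err k i y)\<^sup>2 \<partial>ranks {..<2 * N}) + 2 / n * (\<integral>y. dev L k y \<partial>ranks {..<2 * N}) + 1 / n\<^sup>2"
    by linarith
  moreover have "2 / n * (\<integral>y. dev L k y \<partial>ranks {..<2 * N})
      \<le> 2 / n * (1 / L + (real L + 1) * (\<epsilon> + 1 / (n * \<epsilon>)))"
    by (intro mult_left_mono[OF dev(2)]) simp
  ultimately show ?case using Suc by (simp add: distrib_right)
qed (simp add: err_0)

lemma expectation_level_error: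
  fixes L :: nat and \<epsilon> \<epsilon>' :: real
  assumes "Suc k < K" "L > 0" "\<epsilon> > 0" "\<epsilon>' > 0"
  shows "(\<integral>y. \<bar>act (Suc k) y - exp (- act k y)\<bar> \<partial>ranks {..<2 * N})
    \<le> 1 / n + \<epsilon>' + (2 * (1 / L + (real L + 1) * (\<epsilon> + 1 / (n * \<epsilon>))) + 1 / n) / \<epsilon>'"
proof -
  interpret prob_space "ranks {..<2 * N}" by (rule prob_space_ranks)
  have int: "integrable (ranks {..<2 * N}) (\<lambda>y. (err k n y)\<^sup>2)"
    using assms(1) by (intro integrable_err_sq) auto
  have act: "integrable (ranks {..<2 * N}) (act (Suc k))" "integrable (ranks {..<2 * N}) (act k)"
    using assms(1) by (auto intro!: integrable_act)
  have lhs: "integrable (ranks {..<2 * N}) (\<lambda>y. \<bar>act (Suc k) y - exp (- act k y)\<bar>)"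
  proof (rule integrable_ranks_bounded[where B = 2])
    show "(\<lambda>y. \<bar>act (Suc k) y - exp (- act k y)\<bar>) \<in> borel_measurable (ranks {..<2 * N})"
      using act[THEN borel_measurable_integrable] by measurable
    show "\<bar>\<bar>act (Suc k) y - exp (- act k y)\<bar>\<bar> \<le> 2" for y
    proof -
      have "exp (- act k y) \<le> 1" "0 \<le> exp (- act k y)" using act_bounds(1)[of k y] by auto
      then show ?thesis using act_bounds[of "Suc k" y] by linarith
    qed
  qed
  have "\<bar>act (Suc k) y - exp (- act k y)\<bar> \<le> 1 / n + (\<epsilon>' + (err k n y)\<^sup>2 / \<epsilon>')" for y
  proof -
    have "\<bar>(1 - 1 / n) ^ used k n y - exp (- act k y)\<bar> \<le> 1 / n"
      unfolding act_eq_used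
      by (rule power_one_minus_inverse_approx[OF n_pos used_bound]) simp
    moreover have "\<bar>err k n y\<bar> \<le> \<epsilon>' + (err k n y)\<^sup>2 / \<epsilon>'"
      by (rule abs_le_square_split[OF assms(4)])
    ultimately show ?thesis unfolding err_n by linarith
  qed
  then have "(\<integral>y. \<bar>act (Suc k) y - exp (- act k y)\<bar> \<partial>ranks {..<2 * N})
      \<le> (\<integral>y. 1 / n + (\<epsilon>' + (err k n y)\<^sup>2 / \<epsilon>') \<partial>ranks {..<2 * N})"
    using lhs int by (intro integral_mono) auto
  also have "\<dots> = 1 / n + \<epsilon>' + (\<integral>y. (err k n y)\<^sup>2 \<partial>ranks {..<2 * N}) / \<epsilon>'"
    using int by (simp add: prob_space)
  also have "(\<integral>y. (err k n y)\<^sup>2 \<partial>ranks {..<2 * N})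
      \<le> n * (2 / n * (1 / L + (real L + 1) * (\<epsilon> + 1 / (n * \<epsilon>))) + 1 / n\<^sup>2)"
    using assms by (intro expectation_err_sq) auto
  also have "\<dots> = 2 * (1 / L + (real L + 1) * (\<epsilon> + 1 / (n * \<epsilon>))) + 1 / n"
    using n_pos by (simp add: distrib_left power2_eq_square)
  finally show ?thesis using assms by (simp add: divide_right_mono)
qed

lemma expectation_act_limit:
  fixes \<eta> :: real
  assumes "\<And>k. Suc k < K \<Longrightarrow> (\<integral>y. \<bar>act (Suc k) y - exp (- act k y)\<bar> \<partial>ranks {..<2 * N}) \<le> \<eta>"
    and "k < K"
  shows "(\<integral>y. \<bar>act k y - limit_act k\<bar> \<partial>ranks {..<2 * N}) \<le> k * \<eta>"
  using assms(2)
proof (induction k)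
  case (Suc k)
  interpret prob_space "ranks {..<2 * N}" by (rule prob_space_ranks)
  have act [simp]: "integrable (ranks {..<2 * N}) (act (Suc k))" "integrable (ranks {..<2 * N}) (act k)"
    using Suc.prems by (auto intro!: integrable_act)
  have e [simp]: "integrable (ranks {..<2 * N}) (\<lambda>y. exp (- act k y))"
  proof (rule integrable_ranks_bounded[where B = 1])
    show "(\<lambda>y. exp (- act k y)) \<in> borel_measurable (ranks {..<2 * N})"
      using act(2)[THEN borel_measurable_integrable] by measurable
  qed (use act_bounds in simp)
  have "\<bar>act (Suc k) y - limit_act (Suc k)\<bar>
      \<le> \<bar>act (Suc k) y - exp (- act k y)\<bar> + \<bar>act k y - limit_act k\<bar>" for y
  proof -
    have "0 \<le> limit_act k" using limit_act_bounds[of k] by (meson exp_ge_zero order_trans)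
    then have "\<bar>exp (- act k y) - exp (- limit_act k)\<bar> \<le> \<bar>act k y - limit_act k\<bar>"
      using exp_minus_lipschitz[of 0 "act k y" "limit_act k"] act_bounds by simp
    then show ?thesis by simp
  qed
  then have "(\<integral>y. \<bar>act (Suc k) y - limit_act (Suc k)\<bar> \<partial>ranks {..<2 * N})
      \<le> (\<integral>y. \<bar>act (Suc k) y - exp (- act k y)\<bar> + \<bar>act k y - limit_act k\<bar> \<partial>ranks {..<2 * N})"
    by (intro integral_mono) auto
  also have "\<dots> = (\<integral>y. \<bar>act (Suc k) y - exp (- act k y)\<bar> \<partial>ranks {..<2 * N})
      + (\<integral>y. \<bar>act k y - limit_act k\<bar> \<partial>ranks {..<2 * N})"
    by (intro Bochner_Integration.integral_add) auto
  also have "\<dots> \<le> \<eta> + k * \<eta>" using Suc by (intro add_mono assms(1)) auto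
  finally show ?case by (simp add: distrib_right)
qed (simp add: act_0)

lemma rank_measure_inst: "rank_measure inst = ranks {..<2 * N}"
  by (simp add: rank_measure_def)

lemma expected_ranking_le:
  fixes \<eta> :: real
  assumes "\<And>k. Suc k < K \<Longrightarrow> (\<integral>y. \<bar>act (Suc k) y - exp (- act k y)\<bar> \<partial>ranks {..<2 * N}) \<le> \<eta>"
    and "\<eta> \<ge> 0"
  shows "expected_ranking inst \<le> n * ((\<Sum>k<K. limit_act k) + K * (K * \<eta>))"
proof -
  interpret prob_space "ranks {..<2 * N}" by (rule prob_space_ranks)
  have "expected_ranking inst = n * (\<Sum>k<K. \<integral>y. act k y \<partial>ranks {..<2 * N})"
    using integrable_act by (simp add: expected_ranking_def rank_measure_inst card_ranking_eq_sum_act)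
  also have "(\<Sum>k<K. \<integral>y. act k y \<partial>ranks {..<2 * N}) \<le> (\<Sum>k<K. limit_act k + K * \<eta>)"
  proof (rule sum_mono)
    fix k assume "k \<in> {..<K}"
    then have k: "k < K" by simp
    have "(\<integral>y. act k y \<partial>ranks {..<2 * N}) \<le> (\<integral>y. limit_act k + \<bar>act k y - limit_act k\<bar> \<partial>ranks {..<2 * N})"
      using integrable_act[OF k] by (intro integral_mono) auto
    also have "\<dots> = limit_act k + (\<integral>y. \<bar>act k y - limit_act k\<bar> \<partial>ranks {..<2 * N})"
      using integrable_act[OF k] by (simp add: prob_space)
    also have "\<dots> \<le> limit_act k + k * \<eta>" using expectation_act_limit[OF assms(1) k] by simp
    also have "\<dots> \<le> limit_act k + K * \<eta>" using k assms(2) by (simp add: mult_right_mono)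
    finally show "(\<integral>y. act k y \<partial>ranks {..<2 * N}) \<le> limit_act k + K * \<eta>" .
  qed
  finally show ?thesis by (simp add: sum.distrib mult_left_mono)
qed

end

lemma exists_level_size:
  fixes \<eta> :: real
  assumes "\<eta> > 0"
  obtains n where "n > 0" and
    "\<And>K k. Suc k < K \<Longrightarrow>
      (\<integral>y. \<bar>layered.act n K (Suc k) y - exp (- layered.act n K k y)\<bar> \<partial>ranks {..<2 * layered.N n K}) \<le> \<eta>"
proof -
  define \<epsilon>' where "\<epsilon>' = \<eta> / 4"
  have e': "\<epsilon>' > 0" using assms by (simp add: \<epsilon>'_def)
  obtain L' :: nat where "inverse (real (Suc L')) < \<epsilon>' * \<epsilon>' / 4"
    using reals_Archimedean[of "\<epsilon>' * \<epsilon>' / 4"] e' by auto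
  then obtain L :: nat where L: "L > 0" "1 / L < \<epsilon>' * \<epsilon>' / 4"
    by (metis inverse_eq_divide zero_less_Suc)
  define \<epsilon> where "\<epsilon> = \<epsilon>' * \<epsilon>' / (4 * (real L + 1))"
  have e: "\<epsilon> > 0" using e' by (simp add: \<epsilon>_def)
  have "(real L + 1) * \<epsilon> = \<epsilon>' * \<epsilon>' / 4" by (simp add: \<epsilon>_def field_simps)
  then have "1 / L + (real L + 1) * \<epsilon> < \<epsilon>' * \<epsilon>' / 4 + \<epsilon>' * \<epsilon>' / 4"
    using L by (intro add_less_le_mono) auto
  then have "2 * (1 / L + (real L + 1) * \<epsilon>) < \<epsilon>' * \<epsilon>'" by simp
  then have "2 * (1 / L + (real L + 1) * \<epsilon>) / \<epsilon>' < \<epsilon>'" using e' by (simp add: field_simps)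
  then have lim: "\<epsilon>' + 2 * (1 / L + (real L + 1) * \<epsilon>) / \<epsilon>' < \<eta>"
    using e' \<epsilon>'_def by linarith
  define f where "f n = 1 / n + \<epsilon>' + (2 * (1 / L + (real L + 1) * (\<epsilon> + 1 / \<epsilon> * (1 / n))) + 1 / n) / \<epsilon>'" for n :: nat
  have "f \<longlonglongrightarrow> 0 + \<epsilon>' + (2 * (1 / L + (real L + 1) * (\<epsilon> + 1 / \<epsilon> * 0)) + 0) / \<epsilon>'"
    unfolding f_def using e' by (intro tendsto_intros lim_1_over_n) auto
  then have "\<forall>\<^sub>F n in sequentially. f n < \<eta>" using lim by (intro order_tendstoD) auto
  then have "\<forall>\<^sub>F n in sequentially. f n < \<eta> \<and> n > 0"
    using eventually_gt_at_top by (rule eventually_conj)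
  then obtain n where n: "f n < \<eta>" "n > 0"
    by (auto simp: eventually_sequentially)
  interpret layered n K for K by unfold_locales (rule n(2))
  show thesis
  proof (rule that[OF n(2)])
    fix K k assume "Suc k < K"
    from expectation_level_error[OF this L(1) e e'] n(1)
    show "(\<integral>y. \<bar>act K (Suc k) y - exp (- act K k y)\<bar> \<partial>ranks {..<2 * N K}) \<le> \<eta>"
      by (simp add: f_def mult.commute)
  qed
qed

lemma omega_constant:
  obtains \<omega> :: real where "exp (- \<omega>) = \<omega>" "exp (- 1) \<le> \<omega>" "\<omega> < 0.567149"
proof -
  define c :: real where "c = 0.567149"
  have "1 / c < (\<Sum>k<10. c ^ k /\<^sub>R fact k)"
    by (simp add: c_def eval_nat_numeral fact_numeral)
  also have "\<dots> \<le> exp c"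
    unfolding exp_def by (rule sum_le_suminf[OF summable_exp_generic]) (auto simp: c_def)
  finally have c: "exp (- c) < c" by (simp add: exp_minus c_def field_simps)
  have "\<exists>x\<ge>exp (- 1). x \<le> c \<and> x - exp (- x) = 0"
  proof (rule IVT')
    show "exp (- 1) - exp (- exp (- 1)) \<le> (0::real)" by simp
    show "exp (- 1) \<le> c"
    proof -
      have "exp (- 1) \<le> exp (- c)" by (simp add: c_def)
      then show ?thesis using c by linarith
    qed
  qed (use c in \<open>auto intro!: continuous_intros\<close>)
  then obtain x where "exp (- 1) \<le> x" "x \<le> c" "exp (- x) = x" by auto
  moreover have "x \<noteq> c" using c calculation(3) by auto
  ultimately show thesis using that by (simp add: c_def)
qed

lemma sum_limit_act_le:
  assumes "exp (- \<omega>) = \<omega>" "exp (- 1) \<le> \<omega>"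
  shows "(\<Sum>k<K. limit_act k) \<le> K * \<omega> + 1 / (1 - exp (- exp (- 1)))"
proof -
  define l :: real where "l = exp (- exp (- 1))"
  have l01: "0 < l" "l < 1" by (auto simp: l_def)
  have "0 \<le> \<omega>" "\<omega> \<le> 1"
  proof -
    show "0 \<le> \<omega>" using assms(1) by (metis exp_ge_zero)
    then show "\<omega> \<le> 1" using assms(1) by (metis exp_le_one_iff neg_le_0_iff_le)
  qed
  have "\<bar>limit_act k - \<omega>\<bar> \<le> l ^ k" for k
  proof (induction k)
    case 0
    then show ?case using \<open>0 \<le> \<omega>\<close> \<open>\<omega> \<le> 1\<close> by simp
  next
    case (Suc k)
    have "\<bar>limit_act (Suc k) - \<omega>\<bar> = \<bar>exp (- limit_act k) - exp (- \<omega>)\<bar>" using assms(1) by simp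
    also have "\<dots> \<le> l * \<bar>limit_act k - \<omega>\<bar>"
      unfolding l_def using limit_act_bounds assms(2) by (intro exp_minus_lipschitz) auto
    also have "\<dots> \<le> l * l ^ k" using Suc l01 by (intro mult_left_mono) auto
    finally show ?case by simp
  qed
  then have "limit_act k \<le> \<omega> + l ^ k" for k by (smt (verit))
  then have "(\<Sum>k<K. limit_act k) \<le> (\<Sum>k<K. \<omega> + l ^ k)" by (intro sum_mono)
  also have "\<dots> = K * \<omega> + (\<Sum>k<K. l ^ k)" by (simp add: sum.distrib)
  also have "(\<Sum>k<K. l ^ k) \<le> 1 / (1 - l)"
    using sum_le_suminf[of "\<lambda>k. l ^ k" "{..<K}"] l01 by (simp add: summable_geometric suminf_geometric)
  finally show ?thesis by (simp add: l_def)
qed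

theorem theorem4:
  shows "ranking_ratio < 0.5671 + 0.00005"
proof -
  obtain \<omega> :: real where \<omega>: "exp (- \<omega>) = \<omega>" "exp (- 1) \<le> \<omega>" "\<omega> < 0.567149"
    by (rule omega_constant)
  define C :: real where "C = 1 / (1 - exp (- exp (- 1)))"
  define \<gamma> :: real where "\<gamma> = 0.0000001"
  obtain K :: nat where "C / \<gamma> < K" using reals_Archimedean2 by blast
  moreover have "C > 0" by (simp add: C_def)
  ultimately have K: "C < K * \<gamma>" "K > 0"
    by (auto simp: \<gamma>_def field_simps intro!: Nat.gr0I)
  obtain n where n: "n > 0" and act: "\<And>K' k. Suc k < K' \<Longrightarrow>
      (\<integral>y. \<bar>layered.act n K' (Suc k) y - exp (- layered.act n K' k y)\<bar> \<partial>ranks {..<2 * layered.N n K'})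
      \<le> \<gamma> / K"
    using exists_level_size[of "\<gamma> / K"] K by (auto simp: \<gamma>_def)
  interpret layered n K by unfold_locales (rule n)
  have "expected_ranking inst \<le> n * ((\<Sum>k<K. limit_act k) + K * (K * (\<gamma> / K)))"
    by (rule expected_ranking_le[OF act]) (auto simp: \<gamma>_def)
  also have "\<dots> \<le> n * (K * (\<omega> + 2 * \<gamma>))"
    using sum_limit_act_le[OF \<omega>(1,2), of K] K
    by (intro mult_left_mono) (auto simp: C_def algebra_simps)
  finally have E: "expected_ranking inst \<le> N * (\<omega> + 2 * \<gamma>)" by (simp add: N_def)
  have N: "N > 0" using n K by (simp add: N_def)
  have "inst \<in> bipartite_instances"
    using inst_valid inst_bipartite opt_ge N by (simp add: bipartite_instances_def)
  then have "ranking_ratio \<le> expected_ranking inst / opt inst"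
    unfolding ranking_ratio_def by (rule cINF_lower[OF bdd_below_ranking_ratio])
  also have "\<dots> \<le> expected_ranking inst / N"
    using opt_ge N by (intro divide_left_mono) (auto simp: expected_ranking_def)
  also have "\<dots> \<le> \<omega> + 2 * \<gamma>" using E N by (simp add: field_simps)
  also have "\<dots> < 0.5671 + 0.00005" using \<omega>(3) by (simp add: \<gamma>_def)
  finally show ?thesis .
qed

end
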